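(* Let $N\ge 3$ be an integer, let $0<b_1,b_2<2$, let $2<p_1<\frac{2(N-b_1)}{N-2}$ and $2<p_2<\frac{2(N-b_2)}{N-2}$, and assume $$2<\frac{N(p_1-2)+2b_1}{2}<\frac{N(p_2-2)+2b_2}{2},\qquad b_1<b_2,\qquad p_1<p_2.$$ Let $\phi\in X$ be a positive, radially symmetric and decreasing solution of $$-\Delta\phi=|x|^{-b_2}|\phi|^{p_2-2}\phi-|x|^{-b_1}|\phi|^{p_1-2}\phi\quad\text{in }\mathbb{R}^N .$$ Put $\beta:=\max\left\{\frac{2-b_1}{p_1-2},\,N-2\right\}>0$. Then, as $|x|\to\infty$, $$\phi(x)\sim |x|^{-\beta}\quad\text{if } p_1\ne\frac{2N-2-b_1}{N-2},$$ $$\phi(x)\sim |x|^{2-N}(\ln|x|)^{\frac{2-N}{2-b_1}}\quad\text{if } p_1=\frac{2N-2-b_1}{N-2}.$$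
   Context: $X$ is the completion of $C_0^\infty(\mathbb{R}^N)$ under the norm $$\|u\|_X:=\left(\int_{\mathbb{R}^N}|\nabla u|^2dx\right)^{1/2}+\left(\int_{\mathbb{R}^N}|x|^{-b_1}|u|^{p_1}dx\right)^{1/p_1}.$$ Solutions are understood in the weak sense. For positive functions $f,g$, the notation $f(x)\sim g(x)$ as $|x|\to\infty$ means that there are constants $0<c\le C<\infty$ and $R>0$ such that $c\,g(x)\le f(x)\le C\,g(x)$ for all $|x|\ge R$. *)

theory Defs
  imports "HOL-Analysis.Analysis"
begin

text \<open>All partial derivatives of order at most \<open>k\<close> exist and are continuous; one-step
  differentiability is total, which for the full hierarchy \<open>\<forall>k\<close> gives exactly \<open>C\<^sup>\<infinity>\<close>.\<close>

primrec cont_diff :: "nat \<Rightarrow> ('a::euclidean_space \<Rightarrow> real) \<Rightarrow> bool" where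
  "cont_diff 0 f \<longleftrightarrow> continuous_on UNIV f"
| "cont_diff (Suc k) f \<longleftrightarrow>
     (\<forall>x. f differentiable (at x)) \<and>
     (\<forall>v. cont_diff k (\<lambda>x. frechet_derivative f (at x) v))"

definition test_function :: "('a::euclidean_space \<Rightarrow> real) \<Rightarrow> bool" where
  "test_function \<psi> \<longleftrightarrow> (\<forall>k. cont_diff k \<psi>) \<and> compact (closure {x. \<psi> x \<noteq> 0})"

definition nabla :: "('a::euclidean_space \<Rightarrow> real) \<Rightarrow> 'a \<Rightarrow> 'a" where
  "nabla f x = (\<Sum>i\<in>Basis. frechet_derivative f (at x) i *\<^sub>R i)"

definition locally_integrable ::
  "('a::euclidean_space \<Rightarrow> 'b::euclidean_space) \<Rightarrow> bool" where
  "locally_integrable f \<longleftrightarrow> (\<forall>K. compact K \<longrightarrow> f absolutely_integrable_on K)"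

definition weak_gradient :: "('a::euclidean_space \<Rightarrow> real) \<Rightarrow> ('a \<Rightarrow> 'a) \<Rightarrow> bool" where
  "weak_gradient u G \<longleftrightarrow>
     locally_integrable u \<and> locally_integrable G \<and>
     (\<forall>\<psi>. test_function \<psi> \<longrightarrow> (\<forall>i\<in>Basis.
        (LINT x|lebesgue. u x * (nabla \<psi> x \<bullet> i)) = - (LINT x|lebesgue. (G x \<bullet> i) * \<psi> x)))"

text \<open>The norm \<open>\<parallel>u\<parallel>\<^sub>X\<close>, with the gradient passed separately as \<open>G\<close>. Since a divergent Bochner
  integral has value 0, it is meaningful only together with \<open>X_finite\<close>. The value of
  \<open>norm x powr (- b)\<close> at the origin is 0, on a null set.\<close>

definition X_finite ::
  "real \<Rightarrow> real \<Rightarrow> ('a::euclidean_space \<Rightarrow> real) \<Rightarrow> ('a \<Rightarrow> 'a) \<Rightarrow> bool" where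
  "X_finite b p u G \<longleftrightarrow>
     u \<in> borel_measurable lebesgue \<and> G \<in> borel_measurable lebesgue \<and>
     integrable lebesgue (\<lambda>x. (norm (G x))\<^sup>2) \<and>
     integrable lebesgue (\<lambda>x. norm x powr (- b) * \<bar>u x\<bar> powr p)"

definition X_norm ::
  "real \<Rightarrow> real \<Rightarrow> ('a::euclidean_space \<Rightarrow> real) \<Rightarrow> ('a \<Rightarrow> 'a) \<Rightarrow> real" where
  "X_norm b p u G =
     (LINT x|lebesgue. (norm (G x))\<^sup>2) powr (1 / 2) +
     (LINT x|lebesgue. norm x powr (- b) * \<bar>u x\<bar> powr p) powr (1 / p)"

text \<open>The completion of the test functions under \<open>\<parallel>\<cdot>\<parallel>\<^sub>X\<close>, realised as a space of functions
  (representatives of a.e. classes). If \<open>(\<phi>\<^sub>n)\<close> is Cauchy for \<open>\<parallel>\<cdot>\<parallel>\<^sub>X\<close>, then \<open>\<phi>\<^sub>n\<close> converges to some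
  \<open>u\<close> in the weighted Lebesgue space and \<open>\<nabla>\<phi>\<^sub>n\<close> to some \<open>G\<close> in \<open>L\<^sup>2\<close>. For \<open>b > 0\<close> and \<open>p > 1\<close> the
  first convergence also holds in \<open>L\<^sup>1\<close> on compact sets, so \<open>G\<close> is the weak gradient of \<open>u\<close>: the
  class of the Cauchy sequence is determined by \<open>u\<close>, and the elements of the completion are
  exactly the \<open>X\<close>-limits of sequences of test functions.\<close>

definition X_space :: "real \<Rightarrow> real \<Rightarrow> ('a::euclidean_space \<Rightarrow> real) set" where
  "X_space b p =
     {u. \<exists>G. weak_gradient u G \<and>
        (\<exists>\<phi>. (\<forall>n. test_function (\<phi> n)) \<and>
             (\<forall>n. X_finite b p (\<lambda>x. \<phi> n x - u x) (\<lambda>x. nabla (\<phi> n) x - G x)) \<and>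
             (\<lambda>n. X_norm b p (\<lambda>x. \<phi> n x - u x) (\<lambda>x. nabla (\<phi> n) x - G x))
               \<longlonglongrightarrow> 0)}"

text \<open>\<open>u\<close> is a weak solution of \<open>-\<Delta>u = f\<close> in the whole space. Weak gradients are unique almost
  everywhere, so the existential quantifier involves no choice.\<close>

definition weak_solution ::
  "('a::euclidean_space \<Rightarrow> real) \<Rightarrow> ('a \<Rightarrow> real) \<Rightarrow> bool" where
  "weak_solution u f \<longleftrightarrow>
     locally_integrable f \<and>
     (\<exists>G. weak_gradient u G \<and>
        (\<forall>\<psi>. test_function \<psi> \<longrightarrow>
           (LINT x|lebesgue. G x \<bullet> nabla \<psi> x) = (LINT x|lebesgue. f x * \<psi> x)))"

text \<open>Elements of \<open>X_space\<close> are a.e. classes, so the value at the origin, which may be singular, is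
  left out. Decreasing is understood as nonincreasing in \<open>norm x\<close>.\<close>

definition positive_radial_decreasing :: "('a::euclidean_space \<Rightarrow> real) \<Rightarrow> bool" where
  "positive_radial_decreasing u \<longleftrightarrow>
     (\<forall>x. x \<noteq> 0 \<longrightarrow> 0 < u x) \<and>
     (\<forall>x y. norm x = norm y \<longrightarrow> u x = u y) \<and>
     (\<forall>x y. x \<noteq> 0 \<longrightarrow> norm x \<le> norm y \<longrightarrow> u y \<le> u x)"

definition comparable_at_infinity ::
  "('a::euclidean_space \<Rightarrow> real) \<Rightarrow> ('a \<Rightarrow> real) \<Rightarrow> bool" where
  "comparable_at_infinity f g \<longleftrightarrow>
     (\<exists>c C R. 0 < c \<and> c \<le> C \<and> 0 < R \<and>
        (\<forall>x. R \<le> norm x \<longrightarrow> c * g x \<le> f x \<and> f x \<le> C * g x))"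

end

theory Submission
  imports Defs
begin

text \<open>Write \<open>\<phi> x = v (x \<bullet> x)\<close>. Away from the origin the nonincreasing profile is bounded, so
  \<open>b1 < b2\<close> and \<open>p1 < p2\<close> make \<open>|x|\<^bsup>-b2\<^esup> \<phi>\<^bsup>p2-1\<^esup>\<close> at most half of \<open>|x|\<^bsup>-b1\<^esup> \<phi>\<^bsup>p1-1\<^esup>\<close> near infinity:
  the Laplacian of \<open>\<phi>\<close> is comparable to \<open>|x|\<^bsup>-b1\<^esup> \<phi>\<^bsup>p1-1\<^esup>\<close>. Hence
  the lower power alone decides the decay, and the problem is one about ordinary differential
  inequalities.

  The ordinary differential equation is obtained from the weak one directly. Testing the weak
  equation with functions of \<open>x \<bullet> x\<close> and integrating in polar coordinates gives the equation for
  \<open>v\<close> tested against smooth functions of one variable; letting a smooth cutoff tend to the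
  indicator of \<open>{..b}\<close> yields an explicit formula for \<open>v b\<close> by integrals over \<open>{0..b}\<close>
  (\<open>profile_eq\<close>). The monotonicity of \<open>v\<close> controls the boundary term and gives the formula at
  every point rather than almost everywhere. The right-hand side is continuous, then
  differentiable, so \<open>v\<close> is a classical solution on the half line (\<open>profile_ode\<close>).

  In the variable \<open>t = |x|\<^bsup>N-2\<^esup>\<close>, in which \<open>z t = t \<phi>\<close> has vanishing second derivative exactly for
  harmonic \<open>\<phi>\<close>, the equation becomes \<open>z'' \<sim> t\<^bsup>\<gamma>-2\<^esup> z\<^bsup>p1-1\<^esup>\<close> with
  \<open>\<gamma> = 2 - p1 + (2 - b1) / (N - 2)\<close> (\<open>emden_fowler_of_radial_ode\<close>). Since \<open>\<phi>\<close> tends to \<open>0\<close>, the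
  convex function \<open>z\<close> is sublinear and hence nonincreasing. The sign of \<open>\<gamma>\<close> separates three
  regimes: for \<open>\<gamma> < 0\<close> the right-hand side is so small that \<open>z\<close> has a positive limit
  (\<open>asymp_neg\<close>), and \<open>\<phi>\<close> decays like the fundamental solution \<open>|x|\<^bsup>2-N\<^esup>\<close>; for \<open>\<gamma> > 0\<close> the equation
  forces the self-similar decay \<open>z \<sim> t\<^bsup>-\<gamma>/(p1-2)\<^esup>\<close> (\<open>asymp_pos\<close>), that is
  \<open>\<phi> \<sim> |x|\<^bsup>-(2-b1)/(p1-2)\<^esup>\<close>; for \<open>\<gamma> = 0\<close>, which is the exponent \<open>p1 = (2N-2-b1)/(N-2)\<close>, \<open>z\<close>
  behaves like a solution of \<open>z' = - z\<^bsup>p1-1\<^esup> / t\<close>, which decays logarithmically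
  (\<open>asymp_critical\<close>).\<close>

section \<open>Smooth functions and a smooth cutoff\<close>

text \<open>The hierarchy \<open>cont_diff\<close> is defined through \<open>frechet_derivative\<close>. Here any
  derivative found by the usual calculus may be used in its place, which makes induction on the
  order convenient.\<close>

lemma cont_diff_SucI:
  fixes f :: "'a::euclidean_space \<Rightarrow> real"
  assumes "\<And>x. (f has_derivative f' x) (at x)" and "\<And>v. cont_diff k (\<lambda>x. f' x v)"
  shows "cont_diff (Suc k) f"
proof -
  have "frechet_derivative f (at x) = f' x" for x
    using frechet_derivative_at[OF assms(1)] by simp
  with assms show ?thesis by (auto simp: differentiable_def)
qed

lemma cont_diff_Suc_has_derivative:
  assumes "cont_diff (Suc k) f"
  shows "(f has_derivative frechet_derivative f (at x)) (at x)"
  using assms by (simp add: frechet_derivative_works)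

lemma cont_diff_SucD: "cont_diff (Suc k) f \<Longrightarrow> cont_diff k f"
proof (induction k arbitrary: f)
  case 0
  then show ?case
    by (auto intro!: continuous_at_imp_continuous_on differentiable_imp_continuous_within)
next
  case (Suc k)
  from Suc.prems have "cont_diff (Suc k) (\<lambda>x. frechet_derivative f (at x) v)" for v
    by simp
  then show ?case using Suc.IH Suc.prems by (metis cont_diff.simps(2))
qed

lemma cont_diff_const: "cont_diff k (\<lambda>x. c)"
proof (induction k arbitrary: c)
  case (Suc k)
  then show ?case by (intro cont_diff_SucI[where f'="\<lambda>x v. 0"]) auto
qed simp

lemma cont_diff_bounded_linear:
  assumes "bounded_linear f"
  shows "cont_diff k f"
proof (cases k)
  case 0
  then show ?thesis
    using assms by (simp add: linear_continuous_on)
next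
  case (Suc j)
  show ?thesis
    unfolding Suc using assms
    by (intro cont_diff_SucI[where f'="\<lambda>x. f"] cont_diff_const bounded_linear_imp_has_derivative)
qed

lemma cont_diff_add:
  "cont_diff k f \<Longrightarrow> cont_diff k g \<Longrightarrow> cont_diff k (\<lambda>x. f x + g x)"
proof (induction k arbitrary: f g)
  case 0
  then show ?case by (auto intro: continuous_intros)
next
  case (Suc k)
  show ?case
  proof (rule cont_diff_SucI)
    show "((\<lambda>x. f x + g x) has_derivative
       (\<lambda>v. frechet_derivative f (at x) v + frechet_derivative g (at x) v)) (at x)" for x
      by (rule has_derivative_add[OF Suc.prems[THEN cont_diff_Suc_has_derivative]])
    show "cont_diff k (\<lambda>x. frechet_derivative f (at x) v + frechet_derivative g (at x) v)" for v
      using Suc.prems by (intro Suc.IH) auto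
  qed
qed

lemma cont_diff_mult:
  "cont_diff k f \<Longrightarrow> cont_diff k g \<Longrightarrow> cont_diff k (\<lambda>x. f x * g x)"
proof (induction k arbitrary: f g)
  case 0
  then show ?case by (auto intro: continuous_intros)
next
  case (Suc k)
  show ?case
  proof (rule cont_diff_SucI)
    show "((\<lambda>x. f x * g x) has_derivative
       (\<lambda>v. f x * frechet_derivative g (at x) v + frechet_derivative f (at x) v * g x)) (at x)" for x
      by (rule has_derivative_mult[OF Suc.prems[THEN cont_diff_Suc_has_derivative]])
    show "cont_diff k (\<lambda>x. f x * frechet_derivative g (at x) v + frechet_derivative f (at x) v * g x)" for v
      using Suc.prems cont_diff_SucD[OF Suc.prems(1)] cont_diff_SucD[OF Suc.prems(2)]
      by (intro cont_diff_add Suc.IH) auto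
  qed
qed

lemma frechet_derivative_real:
  fixes g :: "real \<Rightarrow> real"
  assumes "g differentiable (at y)"
  shows "frechet_derivative g (at y) v = v * frechet_derivative g (at y) 1"
  using linear_scale[OF linear_frechet_derivative[OF assms], of v 1] by simp

lemma cont_diff_compose:
  fixes g :: "real \<Rightarrow> real"
  shows "cont_diff k g \<Longrightarrow> cont_diff k f \<Longrightarrow> cont_diff k (\<lambda>x. g (f x))"
proof (induction k arbitrary: f g)
  case 0
  then show ?case by (auto intro: continuous_on_compose2)
next
  case (Suc k)
  show ?case
  proof (rule cont_diff_SucI)
    have "((\<lambda>x. g (f x)) has_derivative
       (\<lambda>v. frechet_derivative g (at (f x)) (frechet_derivative f (at x) v))) (at x)" for x
      by (rule has_derivative_compose[OF cont_diff_Suc_has_derivative[OF Suc.prems(2)]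
            cont_diff_Suc_has_derivative[OF Suc.prems(1)]])
    moreover have "(\<lambda>v. frechet_derivative g (at (f x)) (frechet_derivative f (at x) v)) =
        (\<lambda>v. frechet_derivative f (at x) v * frechet_derivative g (at (f x)) 1)" for x
      using Suc.prems(1) by (intro ext frechet_derivative_real) auto
    ultimately show "((\<lambda>x. g (f x)) has_derivative
       (\<lambda>v. frechet_derivative f (at x) v * frechet_derivative g (at (f x)) 1)) (at x)" for x
      by metis
    show "cont_diff k (\<lambda>x. frechet_derivative f (at x) v * frechet_derivative g (at (f x)) 1)" for v
    proof (intro cont_diff_mult)
      show "cont_diff k (\<lambda>x. frechet_derivative f (at x) v)"
        using Suc.prems(2) by simp
      show "cont_diff k (\<lambda>x. frechet_derivative g (at (f x)) 1)"
        using Suc.IH[of "\<lambda>y. frechet_derivative g (at y) 1" f] Suc.prems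
        by (metis cont_diff.simps(2) cont_diff_SucD)
    qed
  qed
qed

text \<open>One order is gained by integration. This is how all smooth functions of one variable below are
  obtained: from a smooth bump by taking antiderivatives twice.\<close>

lemma cont_diff_antiderivative:
  fixes f :: "real \<Rightarrow> real"
  assumes "\<And>x. (F has_real_derivative f x) (at x)" and "cont_diff k f"
  shows "cont_diff (Suc k) F"
  using assms
  by (intro cont_diff_SucI[where f'="\<lambda>x v. f x * v"])
     (auto simp: has_field_derivative_def intro: cont_diff_mult cont_diff_const)

lemma cont_diff_inner_self: "cont_diff k (\<lambda>x::'a::euclidean_space. x \<bullet> x)"
proof -
  have "cont_diff (Suc k) (\<lambda>x::'a. x \<bullet> x)"
  proof (rule cont_diff_SucI)
    show "((\<lambda>x::'a. x \<bullet> x) has_derivative (\<lambda>v. 2 * (x \<bullet> v))) (at x)" for x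
      by (auto intro!: derivative_eq_intros simp: inner_commute)
    show "cont_diff k (\<lambda>x::'a. 2 * (x \<bullet> v))" for v
      by (intro cont_diff_mult cont_diff_const cont_diff_bounded_linear bounded_linear_inner_left)
  qed
  then show ?thesis by (rule cont_diff_SucD)
qed

text \<open>The factors \<open>(1/x)^k\<close> are included because the derivative of a member of the family is a linear
  combination of two members; this makes the smoothness of the flat function \<open>flat_exp 0\<close> a plain
  induction.\<close>

definition flat_exp :: "nat \<Rightarrow> real \<Rightarrow> real" where
  "flat_exp k x = (if x > 0 then (1/x)^k * exp (- (1/x)) else 0)"

lemma flat_exp_tendsto_0: "(flat_exp k \<longlongrightarrow> 0) (at 0)"
proof -
  have "((\<lambda>y. y^k / exp y) \<longlongrightarrow> (0::real)) at_top" by (rule tendsto_power_div_exp_0)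
  then have "((\<lambda>x. (1/x)^k / exp (1/x)) \<longlongrightarrow> (0::real)) (at_right 0)"
    using filterlim_inverse_at_top_right
    by (auto simp: inverse_eq_divide intro: filterlim_compose)
  then have "(flat_exp k \<longlongrightarrow> 0) (at_right 0)"
    by (rule Lim_transform_eventually)
       (auto simp: flat_exp_def exp_minus field_simps eventually_at_right_less
          intro!: eventually_at_rightI[of 0 1])
  moreover have "(flat_exp k \<longlongrightarrow> 0) (at_left 0)"
    by (rule Lim_transform_eventually[OF tendsto_const])
       (auto simp: flat_exp_def intro!: eventually_at_leftI[of "-1" 0])
  ultimately show ?thesis by (simp add: filterlim_at_split)
qed

lemma flat_exp_has_derivative:
  "(flat_exp k has_real_derivative (flat_exp (k+2) x - k * flat_exp (k+1) x)) (at x)"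
proof -
  consider "x > 0" | "x < 0" | "x = 0" by linarith
  then show ?thesis
  proof cases
    case 1
    have "((\<lambda>x. (1/x)^k * exp (- (1/x))) has_real_derivative
        (1/x)^(k+2) * exp (- (1/x)) - k * ((1/x)^(k+1) * exp (- (1/x)))) (at x)"
    proof (cases k)
      case (Suc j)
      have "((\<lambda>x. (1/x)^Suc j * exp (- (1/x))) has_real_derivative
          (Suc j * (1/x)^j * (- ((1/x)^2))) * exp (- (1/x)) + (1/x)^Suc j * (exp (- (1/x)) * (1/x)^2)) (at x)"
        using 1 by (auto intro!: derivative_eq_intros simp: power2_eq_square simp del: power_Suc)
      then show ?thesis by (simp add: Suc algebra_simps power2_eq_square add_divide_distrib)
    qed (use 1 in \<open>auto intro!: derivative_eq_intros simp: power2_eq_square\<close>)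
    then show ?thesis
      using 1
      by (auto simp: flat_exp_def
          intro: has_field_derivative_transform_within_open[where S="{0<..}"])
  next
    case 2
    have "((\<lambda>x. 0) has_real_derivative 0) (at x)" by simp
    then show ?thesis
      using 2
      by (auto simp: flat_exp_def
          intro: has_field_derivative_transform_within_open[where S="{..<0}" and f="\<lambda>x. 0"])
  next
    case 3
    have "((\<lambda>h. (flat_exp k (0 + h) - flat_exp k 0) / h) \<longlongrightarrow> 0) (at 0)"
      using flat_exp_tendsto_0[of "Suc k"]
      by (rule Lim_transform_eventually) (auto simp: flat_exp_def eventually_at_filter)
    then show ?thesis using 3 by (simp add: DERIV_def flat_exp_def)
  qed
qed

lemma cont_diff_flat_exp: "cont_diff m (flat_exp k)"
proof (induction m arbitrary: k)
  case 0
  show ?case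
    using flat_exp_has_derivative by (auto intro!: continuous_at_imp_continuous_on DERIV_isCont)
next
  case (Suc m)
  have "cont_diff m (\<lambda>x. flat_exp (k+2) x + (- real k) * flat_exp (k+1) x)"
    by (intro cont_diff_add cont_diff_mult cont_diff_const Suc)
  then show ?case
    by (intro cont_diff_antiderivative[OF flat_exp_has_derivative]) auto
qed

lemma antiderivative_vanishing_left:
  fixes f :: "real \<Rightarrow> real"
  assumes cont: "continuous_on UNIV f" and zero: "\<And>x. x \<le> 0 \<Longrightarrow> f x = 0"
  obtains F where "\<And>x. (F has_real_derivative f x) (at x)" and "\<And>x. x \<le> 0 \<Longrightarrow> F x = 0"
proof
  define F where "F x = integral {-1..x} f" for x
  show F0: "F x = 0" if "x \<le> 0" for x
  proof -
    have "integral {-1..x} f = integral {-1..x} (\<lambda>_. 0)"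
      using that zero by (intro integral_cong) auto
    then show ?thesis by (simp add: F_def)
  qed
  show "(F has_real_derivative f x) (at x)" for x
  proof (cases "x < 0")
    case True
    have "((\<lambda>x. 0) has_real_derivative 0) (at x)" by simp
    then have "(F has_real_derivative 0) (at x)"
      using True F0
      by (auto intro: has_field_derivative_transform_within_open[where S="{..<0}" and f="\<lambda>x. 0"])
    then show ?thesis using zero[of x] True by simp
  next
    case False
    have "(F has_real_derivative f x) (at x within {-1..x+1})"
      unfolding F_def using False
      by (intro integral_has_real_derivative continuous_on_subset[OF cont]) auto
    moreover have "at x within {-1..x+1} = at x"
      using False by (intro at_within_interior) auto
    ultimately show ?thesis by simp
  qed
qed

text \<open>The cutoff \<open>\<theta>\<close> descends from \<open>1\<close> to \<open>0\<close> on \<open>{0..1}\<close>. What is needed for radial test functions is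
  its antiderivative \<open>\<eta>\<close> that vanishes to the right of \<open>1\<close>: the function \<open>\<lambda>x. \<eta> (x \<bullet> x)\<close>, suitably
  rescaled, then has compact support, while its derivative is the cutoff itself.\<close>

lemma smooth_cutoff_exists:
  obtains \<theta> \<eta> \<theta>' :: "real \<Rightarrow> real"
  where "\<And>t. t \<le> 0 \<Longrightarrow> \<theta> t = 1" "\<And>t. t \<ge> 1 \<Longrightarrow> \<theta> t = 0"
    "\<And>t. (\<theta> has_real_derivative \<theta>' t) (at t)" "\<And>t. \<theta>' t \<le> 0"
    "\<And>t. (\<eta> has_real_derivative \<theta> t) (at t)" "\<And>t. t \<ge> 1 \<Longrightarrow> \<eta> t = 0"
    "\<And>k. cont_diff k \<eta>" "continuous_on UNIV \<theta>'"
proof -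
  define \<rho> where "\<rho> x = flat_exp 0 x * flat_exp 0 (1 - x)" for x
  have smooth_1m: "cont_diff k (\<lambda>x. 1 - x)" for k
    using cont_diff_add[OF cont_diff_const[of k 1] cont_diff_bounded_linear[OF bounded_linear_minus[OF bounded_linear_ident]]]
    by simp
  have \<rho>_smooth: "cont_diff k \<rho>" for k
    unfolding \<rho>_def by (intro cont_diff_mult cont_diff_flat_exp cont_diff_compose[OF _ smooth_1m])
  then have \<rho>_cont: "continuous_on UNIV \<rho>" using cont_diff.simps(1) by blast
  have \<rho>_nonneg: "\<rho> x \<ge> 0" for x by (simp add: \<rho>_def flat_exp_def)
  obtain g where g': "\<And>x. (g has_real_derivative \<rho> x) (at x)" and g0: "\<And>x. x \<le> 0 \<Longrightarrow> g x = 0"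
    using antiderivative_vanishing_left[OF \<rho>_cont] by (auto simp: \<rho>_def flat_exp_def)
  have "g 0 < g 1"
  proof (rule DERIV_pos_imp_increasing_open[of 0 1 g])
    show "\<exists>y. (g has_real_derivative y) (at x) \<and> y > 0" if "0 < x" "x < 1" for x
      using g'[of x] that by (intro exI[of _ "\<rho> x"]) (simp add: \<rho>_def flat_exp_def)
    show "continuous_on {0..1} g"
      using g' by (meson DERIV_isCont continuous_at_imp_continuous_on)
  qed simp
  then have g1: "g 1 > 0" using g0 by simp
  have g_const: "g t = g 1" if "t \<ge> 1" for t
  proof (cases "t = 1")
    case False
    have "\<exists>z. z > 1 \<and> z < t \<and> g t - g 1 = (t - 1) * \<rho> z"
      using that False g' by (intro MVT2) auto
    then show ?thesis by (auto simp: \<rho>_def flat_exp_def)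
  qed simp
  define \<theta> where "\<theta> t = 1 - g t / g 1" for t
  have \<theta>': "(\<theta> has_real_derivative - \<rho> t / g 1) (at t)" for t
    unfolding \<theta>_def using g1 by (auto intro!: derivative_eq_intros g')
  have \<theta>_smooth: "cont_diff k \<theta>" for k
  proof -
    have "cont_diff k (\<lambda>t. (- 1 / g 1) * \<rho> t)"
      by (intro cont_diff_mult cont_diff_const \<rho>_smooth)
    then show ?thesis
      by (intro cont_diff_SucD[OF cont_diff_antiderivative[OF \<theta>']]) simp
  qed
  have \<theta>_0: "\<theta> t = 0" if "t \<ge> 1" for t using g_const[OF that] g1 by (simp add: \<theta>_def)
  have "cont_diff 0 (\<lambda>y. \<theta> (1 - y))"
    by (rule cont_diff_compose[OF \<theta>_smooth smooth_1m])
  then obtain H where H': "\<And>x. (H has_real_derivative \<theta> (1 - x)) (at x)" and H0: "\<And>x. x \<le> 0 \<Longrightarrow> H x = 0"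
    using antiderivative_vanishing_left[of "\<lambda>y. \<theta> (1 - y)"] \<theta>_0 by auto
  define \<eta> where "\<eta> t = - H (1 - t)" for t
  have \<eta>': "(\<eta> has_real_derivative \<theta> t) (at t)" for t
    unfolding \<eta>_def by (auto intro!: derivative_eq_intros DERIV_chain2[OF H'])
  show ?thesis
  proof
    show "\<theta> t = 1" if "t \<le> 0" for t using g0[OF that] by (simp add: \<theta>_def)
    show "(\<theta> has_real_derivative - \<rho> t / g 1) (at t)" for t by (rule \<theta>')
    show "- \<rho> t / g 1 \<le> 0" for t using \<rho>_nonneg[of t] g1 by simp
    show "\<eta> t = 0" if "t \<ge> 1" for t using that H0 by (simp add: \<eta>_def)
    show "cont_diff k \<eta>" for k
      by (intro cont_diff_SucD[OF cont_diff_antiderivative[OF \<eta>']] \<theta>_smooth)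
    show "continuous_on UNIV (\<lambda>t. - \<rho> t / g 1)"
      using g1 by (intro continuous_intros \<rho>_cont) auto
  qed (use \<theta>_0 \<eta>' in auto)
qed

section \<open>Radial test functions\<close>

lemma nabla_inner_Basis:
  "i \<in> Basis \<Longrightarrow> nabla f x \<bullet> i = frechet_derivative f (at x) i"
  by (simp add: nabla_def)

lemma locally_integrable_mult_continuous:
  fixes u g :: "'a::euclidean_space \<Rightarrow> real"
  assumes u: "locally_integrable u" and g: "continuous_on UNIV g"
    and supp: "\<And>x. g x \<noteq> 0 \<Longrightarrow> norm x \<le> r"
  shows "integrable lebesgue (\<lambda>x. u x * g x)"
proof -
  let ?K = "cball 0 r :: 'a set"
  have ui: "integrable lebesgue (\<lambda>x. indicator ?K x *\<^sub>R u x)"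
    using u unfolding locally_integrable_def set_integrable_def by auto
  have "compact (g ` ?K)"
    by (intro compact_continuous_image continuous_on_subset[OF g]) auto
  then obtain B where B: "\<And>x. x \<in> ?K \<Longrightarrow> norm (g x) \<le> B"
    using compact_imp_bounded bounded_iff by (metis imageI)
  have gm: "g \<in> borel_measurable lebesgue"
    using g by (intro measurable_completion) (simp add: borel_measurable_continuous_onI)
  have eq: "u x * g x = (indicator ?K x *\<^sub>R u x) * g x" for x
    using supp[of x] by (auto simp: indicator_def)
  show ?thesis
  proof (rule Bochner_Integration.integrable_bound)
    show "integrable lebesgue (\<lambda>x. B * (indicator ?K x *\<^sub>R u x))"
      using ui by (rule integrable_mult_right)
    show "(\<lambda>x. u x * g x) \<in> borel_measurable lebesgue"
      unfolding eq using borel_measurable_integrable[OF ui] gm by (rule borel_measurable_times)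
    show "AE x in lebesgue. norm (u x * g x) \<le> norm (B * (indicator ?K x *\<^sub>R u x))"
    proof (rule AE_I2)
      fix x :: 'a
      show "norm (u x * g x) \<le> norm (B * (indicator ?K x *\<^sub>R u x))"
      proof (cases "x \<in> ?K")
        case True
        have "\<bar>u x\<bar> * \<bar>g x\<bar> \<le> \<bar>u x\<bar> * \<bar>B\<bar>"
          using B[OF True] by (intro mult_left_mono) auto
        then show ?thesis using True by (simp add: abs_mult mult.commute)
      next
        case False
        then show ?thesis using supp[of x] by auto
      qed
    qed
  qed
qed

lemma locally_integrable_inner:
  fixes G :: "'a::euclidean_space \<Rightarrow> 'a"
  assumes "locally_integrable G"
  shows "locally_integrable (\<lambda>x. G x \<bullet> i)"
  using assms unfolding locally_integrable_def
  by (auto intro: absolutely_integrable_component)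

lemma has_derivative_radial:
  fixes x :: "'a::euclidean_space"
  assumes "\<And>t. (\<eta> has_real_derivative \<kappa> t) (at t)"
  shows "((\<lambda>x. \<eta> (x \<bullet> x)) has_derivative (\<lambda>v. \<kappa> (x \<bullet> x) * (2 * (x \<bullet> v)))) (at x)"
proof -
  have "((\<lambda>x. x \<bullet> x) has_derivative (\<lambda>v. 2 * (x \<bullet> v))) (at x)"
    by (auto intro!: derivative_eq_intros simp: inner_commute)
  from has_derivative_compose[OF this, of \<eta> "(*) (\<kappa> (x \<bullet> x))"] assms[of "x \<bullet> x"]
  show ?thesis by (simp add: has_field_derivative_def)
qed

text \<open>Both derivatives can be moved to the test function: the weak equation is used for
  \<open>\<psi> = \<eta> (x \<bullet> x)\<close>, and the definition of the weak gradient for each partial derivative of \<open>\<psi>\<close>. With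
  \<open>s = x \<bullet> x\<close> the factor of \<open>u\<close> is the Laplacian \<open>4 s \<eta>'' + 2 N \<eta>'\<close> of \<open>\<psi>\<close>.\<close>

lemma weak_solution_radial_test:
  fixes u f :: "'a::euclidean_space \<Rightarrow> real"
  assumes ws: "weak_solution u f"
    and \<eta>: "\<And>t. (\<eta> has_real_derivative \<kappa> t) (at t)"
    and \<kappa>: "\<And>t. (\<kappa> has_real_derivative \<kappa>' t) (at t)"
    and smooth: "\<And>k. cont_diff k \<eta>"
    and cont: "continuous_on UNIV \<kappa>'"
    and \<eta>0: "\<And>t. M \<le> t \<Longrightarrow> \<eta> t = 0" and \<kappa>0: "\<And>t. M \<le> t \<Longrightarrow> \<kappa> t = 0"
  shows "(LINT x|lebesgue. u x * (4 * (x \<bullet> x) * \<kappa>' (x \<bullet> x) + 2 * real DIM('a) * \<kappa> (x \<bullet> x)))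
       = - (LINT x|lebesgue. f x * \<eta> (x \<bullet> x))"
proof -
  define \<psi> where "\<psi> x = \<eta> (x \<bullet> x)" for x :: 'a
  define D where "D i x = \<kappa> (x \<bullet> x) * (2 * (x \<bullet> i))" for i x :: 'a
  define E where "E i x = 4 * \<kappa>' (x \<bullet> x) * (x \<bullet> i)^2 + 2 * \<kappa> (x \<bullet> x)" for i x :: 'a
  have small: "norm x \<le> sqrt M" if "x \<bullet> x < M" for x :: 'a
    using that by (simp add: norm_eq_sqrt_inner)
  have \<psi>': "(\<psi> has_derivative (\<lambda>v. D v x)) (at x)" for x
    unfolding \<psi>_def D_def using has_derivative_radial[OF \<eta>] .
  have f\<psi>: "frechet_derivative \<psi> (at x) v = D v x" for x v
    using frechet_derivative_at[OF \<psi>'] by metis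
  have \<psi>_smooth: "cont_diff k \<psi>" for k
    unfolding \<psi>_def by (rule cont_diff_compose[OF smooth cont_diff_inner_self])
  have \<psi>_test: "test_function \<psi>"
    unfolding test_function_def
  proof (intro conjI allI \<psi>_smooth)
    have "norm x \<le> sqrt M" if "\<psi> x \<noteq> 0" for x
      using that \<eta>0[of "x \<bullet> x"] by (intro small) (force simp: \<psi>_def not_le[symmetric])
    then show "compact (closure {x. \<psi> x \<noteq> 0})"
      by (auto simp: bounded_iff)
  qed
  have D_supp: "norm x \<le> sqrt M" if "D i x \<noteq> 0" for i x
    using that \<kappa>0[of "x \<bullet> x"] by (intro small) (force simp: D_def not_le[symmetric])
  have D_smooth: "cont_diff k (D i)" for k i
    using \<psi>_smooth[of "Suc k"] by (simp add: f\<psi>)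
  have D_test: "test_function (D i)" for i
    unfolding test_function_def using D_smooth D_supp[of i] by (auto simp: bounded_iff)
  have D': "(D i has_derivative
      (\<lambda>v. \<kappa> (x \<bullet> x) * (2 * (v \<bullet> i)) + \<kappa>' (x \<bullet> x) * (2 * (x \<bullet> v)) * (2 * (x \<bullet> i)))) (at x)" for i x
    unfolding D_def
    by (intro has_derivative_mult has_derivative_radial[OF \<kappa>])
       (auto intro!: derivative_eq_intros)
  have fD: "frechet_derivative (D i) (at x) i = E i x" if "i \<in> Basis" for x i
    unfolding frechet_derivative_at[OF D', symmetric] using that
    by (simp add: E_def power2_eq_square)
  from ws obtain G where G: "weak_gradient u G"
    and eq: "\<And>\<psi>. test_function \<psi> \<Longrightarrow>
           (LINT x|lebesgue. G x \<bullet> nabla \<psi> x) = (LINT x|lebesgue. f x * \<psi> x)"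
    unfolding weak_solution_def by blast
  have Gl: "locally_integrable G" and ul: "locally_integrable u"
    using G by (auto simp: weak_gradient_def)
  have "(LINT x|lebesgue. f x * \<psi> x) = (LINT x|lebesgue. G x \<bullet> nabla \<psi> x)"
    using eq[OF \<psi>_test] by simp
  also have "\<dots> = (LINT x|lebesgue. (\<Sum>i\<in>Basis. (G x \<bullet> i) * D i x))"
    by (subst euclidean_inner) (simp add: nabla_inner_Basis f\<psi> cong: sum.cong)
  also have "\<dots> = (\<Sum>i\<in>Basis. LINT x|lebesgue. (G x \<bullet> i) * D i x)"
  proof (rule Bochner_Integration.integral_sum)
    fix i :: 'a
    show "integrable lebesgue (\<lambda>x. (G x \<bullet> i) * D i x)"
      using locally_integrable_inner[OF Gl] D_smooth[of 0 i] D_supp[of i]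
      by (intro locally_integrable_mult_continuous) auto
  qed
  also have "\<dots> = (\<Sum>i\<in>Basis. - (LINT x|lebesgue. u x * E i x))"
  proof (rule sum.cong)
    fix i :: 'a assume i: "i \<in> Basis"
    have "(LINT x|lebesgue. u x * (nabla (D i) x \<bullet> i)) = - (LINT x|lebesgue. (G x \<bullet> i) * D i x)"
      using G i D_test unfolding weak_gradient_def by blast
    then show "(LINT x|lebesgue. (G x \<bullet> i) * D i x) = - (LINT x|lebesgue. u x * E i x)"
      using i by (simp add: nabla_inner_Basis fD)
  qed simp
  also have "\<dots> = - (LINT x|lebesgue. (\<Sum>i\<in>Basis. u x * E i x))"
  proof -
    have "integrable lebesgue (\<lambda>x. u x * E i x)" if "i \<in> Basis" for i
    proof (rule locally_integrable_mult_continuous[OF ul])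
      have \<kappa>_cont: "continuous_on UNIV \<kappa>"
        using \<kappa> by (meson DERIV_isCont continuous_at_imp_continuous_on)
      show "continuous_on UNIV (E i)"
        unfolding E_def
        by (intro continuous_intros continuous_on_compose2[OF cont] continuous_on_compose2[OF \<kappa>_cont]) auto
      show "norm x \<le> sqrt M + 1" if "E i x \<noteq> 0" for x
      proof (rule ccontr)
        assume "\<not> norm x \<le> sqrt M + 1"
        then have "\<not> norm x \<le> sqrt M" by simp
        then have far: "M < x \<bullet> x"
          by (simp add: norm_eq_sqrt_inner)
        have "(\<kappa> has_real_derivative 0) (at (x \<bullet> x))"
          using far \<kappa>0
          by (intro has_field_derivative_transform_within_open[where S="{M<..}" and f="\<lambda>_. 0" and g=\<kappa>]) auto
        then have "\<kappa>' (x \<bullet> x) = 0" using \<kappa> DERIV_unique by blast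
        with \<kappa>0[of "x \<bullet> x"] far that show False by (simp add: E_def)
      qed
    qed
    then show ?thesis by (simp add: Bochner_Integration.integral_sum sum_negf)
  qed
  also have "(\<lambda>x. \<Sum>i\<in>Basis. u x * E i x) =
      (\<lambda>x. u x * (4 * (x \<bullet> x) * \<kappa>' (x \<bullet> x) + 2 * real DIM('a) * \<kappa> (x \<bullet> x)))"
  proof
    fix x :: 'a
    have "(\<Sum>i\<in>Basis. E i x) = 4 * \<kappa>' (x \<bullet> x) * (\<Sum>i\<in>Basis. (x \<bullet> i)^2) + 2 * real DIM('a) * \<kappa> (x \<bullet> x)"
      by (simp add: E_def sum.distrib sum_distrib_left)
    also have "(\<Sum>i\<in>Basis. (x \<bullet> i)^2) = x \<bullet> x"
      by (simp add: euclidean_inner[of x x] power2_eq_square)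
    finally show "(\<Sum>i\<in>Basis. u x * E i x) =
        u x * (4 * (x \<bullet> x) * \<kappa>' (x \<bullet> x) + 2 * real DIM('a) * \<kappa> (x \<bullet> x))"
      by (simp add: sum_distrib_left[symmetric] mult_ac)
  qed
  finally show ?thesis by (simp add: \<psi>_def)
qed

section \<open>Polar coordinates\<close>

text \<open>The density of the image of Lebesgue measure on an \<open>N\<close>-dimensional space under
  \<open>x \<mapsto> x \<bullet> x\<close>, that is, the derivative of the volume \<open>unit_ball_vol N * s powr (N/2)\<close> of the ball
  of squared radius \<open>s\<close>.\<close>

definition radial_density :: "nat \<Rightarrow> real \<Rightarrow> real" where
  "radial_density N s =
     (if 0 < s then real N / 2 * unit_ball_vol (real N) * s powr (real N / 2 - 1) else 0)"

lemma radial_density_nonneg: "0 \<le> radial_density N s"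
  by (simp add: radial_density_def)

lemma borel_measurable_radial_density [measurable]: "radial_density N \<in> borel_measurable borel"
  unfolding radial_density_def by measurable

lemma nn_integral_radial_density:
  assumes "0 < N"
  shows "(\<integral>\<^sup>+s. ennreal (radial_density N s) * indicator {..a} s \<partial>lborel) =
     (if 0 < a then ennreal (unit_ball_vol (real N) * a powr (real N / 2)) else 0)"
proof (cases "0 < a")
  case False
  then have zero: "ennreal (radial_density N s) * indicator {..a} s = 0" for s
    by (auto simp: radial_density_def indicator_def)
  have "(\<integral>\<^sup>+s. ennreal (radial_density N s) * indicator {..a} s \<partial>lborel) = (\<integral>\<^sup>+s. 0 \<partial>(lborel :: real measure))"
    by (rule nn_integral_cong) (rule zero)
  with False show ?thesis by simp
next
  case True
  let ?c = "real N / 2 * unit_ball_vol (real N)"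
  have "((\<lambda>s. ?c * s powr (real N / 2 - 1)) has_integral
      ?c * (a powr (real N / 2 - 1 + 1) / (real N / 2 - 1 + 1))) {0..a}"
    using assms True by (intro has_integral_mult_right has_integral_powr_from_0) auto
  then have "((\<lambda>s. ?c * s powr (real N / 2 - 1)) has_integral
      unit_ball_vol (real N) * a powr (real N / 2)) {0..a}"
    using assms by simp
  then have "((\<lambda>s. if s \<in> {0..a} then ?c * s powr (real N / 2 - 1) else 0) has_integral
      unit_ball_vol (real N) * a powr (real N / 2)) UNIV"
    by (simp only: has_integral_restrict_UNIV)
  also have "(\<lambda>s. if s \<in> {0..a} then ?c * s powr (real N / 2 - 1) else 0) =
      (\<lambda>s. radial_density N s * indicator {..a} s)"
    by (auto simp: radial_density_def indicator_def fun_eq_iff)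
  finally have "(\<integral>\<^sup>+s. ennreal (radial_density N s * indicator {..a} s) \<partial>lborel) =
      ennreal (unit_ball_vol (real N) * a powr (real N / 2))"
    by (intro nn_integral_has_integral_lborel) (auto simp: radial_density_nonneg)
  moreover have "ennreal (radial_density N s * indicator {..a} s) =
      ennreal (radial_density N s) * indicator {..a} s" for s
    by (auto simp: indicator_def)
  ultimately show ?thesis using True by simp
qed

text \<open>Two measures on the line that agree on all half lines \<open>{..a}\<close> are equal, and on these the claim
  is the formula for the volume of a ball.\<close>

lemma distr_inner_self:
  "distr lborel borel (\<lambda>x::'a::euclidean_space. x \<bullet> x) =
   density lborel (\<lambda>s. ennreal (radial_density DIM('a) s))" (is "?L = ?R")
proof (rule measure_eqI_generator_eq[where E="range (\<lambda>a::real. {..a})" and \<Omega>=UNIV and A="\<lambda>i. {..real i}"])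
  show "Int_stable (range (\<lambda>a::real. {..a}))"
    by (auto simp: Int_stable_def)
  have L: "emeasure ?L {..a} =
      (if 0 < a then ennreal (unit_ball_vol (real DIM('a)) * a powr (real DIM('a) / 2)) else 0)" for a
  proof -
    have "emeasure ?L {..a} = emeasure lborel {x::'a. x \<bullet> x \<le> a}"
      by (subst emeasure_distr) (auto simp: vimage_def)
    also have "{x::'a. x \<bullet> x \<le> a} = (if 0 \<le> a then cball 0 (sqrt a) else {})"
      by (auto simp: norm_eq_sqrt_inner) (meson inner_ge_zero order_trans)
    also have "emeasure lborel (\<dots> :: 'a set) =
        (if 0 \<le> a then ennreal (unit_ball_vol (real DIM('a)) * sqrt a ^ DIM('a)) else 0)"
      by (simp add: emeasure_cball)
    also have "\<dots> = (if 0 < a then ennreal (unit_ball_vol (real DIM('a)) * a powr (real DIM('a) / 2)) else 0)"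
      by (auto simp: powr_half_sqrt[symmetric] powr_powr powr_realpow[symmetric])
    finally show ?thesis .
  qed
  show "emeasure ?L X = emeasure ?R X" if "X \<in> range (\<lambda>a::real. {..a})" for X
    using that L by (auto simp: emeasure_density nn_integral_radial_density)
  show "emeasure ?L {..real i} \<noteq> \<infinity>" for i
    unfolding L by auto
  show "(\<Union>i. {..real i}) = (UNIV :: real set)"
    using real_arch_simple by auto
  show "sets ?L = sigma_sets UNIV (range (\<lambda>a::real. {..a}))"
    "sets ?R = sigma_sets UNIV (range (\<lambda>a::real. {..a}))"
    by (simp_all add: borel_eq_atMost)
qed auto

lemma lebesgue_integral_radial:
  fixes g :: "real \<Rightarrow> real"
  assumes [measurable]: "g \<in> borel_measurable borel"
  shows "integrable lebesgue (\<lambda>x::'a::euclidean_space. g (x \<bullet> x)) \<longleftrightarrow>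
           integrable lborel (\<lambda>s. radial_density DIM('a) s * g s)" (is ?I)
    and "(LINT x|lebesgue. g ((x::'a) \<bullet> x)) = (LINT s|lborel. radial_density DIM('a) s * g s)" (is ?E)
proof -
  have "integrable lebesgue (\<lambda>x::'a. g (x \<bullet> x)) \<longleftrightarrow> integrable lborel (\<lambda>x::'a. g (x \<bullet> x))"
    by (intro integrable_completion) simp
  also have "\<dots> \<longleftrightarrow> integrable (distr lborel borel (\<lambda>x::'a. x \<bullet> x)) g"
    by (intro integrable_distr_eq[symmetric]) auto
  also have "\<dots> \<longleftrightarrow> integrable lborel (\<lambda>s. radial_density DIM('a) s * g s)"
    unfolding distr_inner_self by (subst integrable_density) (auto simp: radial_density_nonneg)
  finally show ?I .
  have "(LINT x|lebesgue. g ((x::'a) \<bullet> x)) = (LINT x|lborel. g ((x::'a) \<bullet> x))"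
    by (intro integral_completion) simp
  also have "\<dots> = integral\<^sup>L (distr lborel borel (\<lambda>x::'a. x \<bullet> x)) g"
    by (intro integral_distr[symmetric]) auto
  also have "\<dots> = (LINT s|lborel. radial_density DIM('a) s * g s)"
    unfolding distr_inner_self by (subst integral_density) (auto simp: radial_density_nonneg)
  finally show ?E .
qed

section \<open>The integrated radial equation\<close>

lemma integrable_mult_cutoff:
  fixes g k :: "real \<Rightarrow> real"
  assumes g: "\<And>r. integrable lborel (\<lambda>s. g s * indicator {..r} s)"
    and g0: "\<And>s. s \<le> 0 \<Longrightarrow> g s = 0"
    and k: "continuous_on UNIV k" and k0: "\<And>s. r < s \<Longrightarrow> k s = 0"
  shows "integrable lborel (\<lambda>s. g s * k s)"
proof -
  have "compact (k ` {0..r})"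
    by (intro compact_continuous_image continuous_on_subset[OF k]) auto
  then obtain B where B: "\<And>s. s \<in> {0..r} \<Longrightarrow> norm (k s) \<le> B"
    using compact_imp_bounded bounded_iff by (metis imageI)
  have eq: "g s * k s = (g s * indicator {..r} s) * k s" for s
    using k0[of s] by (auto simp: indicator_def)
  show ?thesis
  proof (rule Bochner_Integration.integrable_bound)
    show "integrable lborel (\<lambda>s. B * (g s * indicator {..r} s))"
      using g by (rule integrable_mult_right)
    show "(\<lambda>s. g s * k s) \<in> borel_measurable lborel"
      unfolding eq using borel_measurable_integrable[OF g[of r]] borel_measurable_continuous_onI[OF k]
      by measurable
    show "AE s in lborel. norm (g s * k s) \<le> norm (B * (g s * indicator {..r} s))"
    proof (rule AE_I2)
      fix s :: real
      show "norm (g s * k s) \<le> norm (B * (g s * indicator {..r} s))"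
      proof (cases "s \<in> {0..r}")
        case True
        have "\<bar>g s\<bar> * \<bar>k s\<bar> \<le> \<bar>g s\<bar> * \<bar>B\<bar>"
          using B[OF True] by (intro mult_left_mono) auto
        then show ?thesis using True by (simp add: abs_mult mult.commute)
      next
        case False
        then show ?thesis using g0[of s] k0[of s] by auto
      qed
    qed
  qed
qed

lemma lborel_integral_cutoff:
  fixes g :: "real \<Rightarrow> real"
  assumes g: "integrable lborel (\<lambda>s. g s * indicator {..b} s)"
    and g0: "\<And>s. s \<le> 0 \<Longrightarrow> g s = 0"
  shows "g integrable_on {0..b}" and "(LINT s|lborel. g s * indicator {..b} s) = integral {0..b} g"
proof -
  have eq: "(\<lambda>s. g s * indicator {..b} s) = (\<lambda>s. indicator {0..b} s *\<^sub>R g s)"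
    using g0 by (force simp: indicator_def fun_eq_iff)
  have "set_integrable lborel {0..b} g"
    using g by (simp add: set_integrable_def eq)
  from set_borel_integral_eq_integral[OF this]
  show "g integrable_on {0..b}" "(LINT s|lborel. g s * indicator {..b} s) = integral {0..b} g"
    by (simp_all add: eq set_lebesgue_integral_def)
qed

text \<open>The weak equation after integration in polar coordinates, with \<open>n = N/2 - 1\<close> and with \<open>W\<close> the
  right-hand side times the weight \<open>s powr n\<close>. The test functions \<open>\<eta>\<close> need not vanish
  near the origin; this is what makes the formulas below start at \<open>0\<close> without boundary terms there.\<close>

locale radial_weak_equation =
  fixes n :: real and v W :: "real \<Rightarrow> real"
  assumes n: "-1 < n"
    and v_nonneg: "\<And>s. 0 < s \<Longrightarrow> 0 \<le> v s"
    and v_antimono: "\<And>s t. 0 < s \<Longrightarrow> s \<le> t \<Longrightarrow> v t \<le> v s"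
    and V_int: "\<And>r. integrable lborel (\<lambda>s. (if 0 < s then s powr n * v s else 0) * indicator {..r} s)"
    and W_int: "\<And>r. integrable lborel (\<lambda>s. W s * indicator {..r} s)"
    and W0: "\<And>s. s \<le> 0 \<Longrightarrow> W s = 0"
    and test: "\<And>\<eta> \<kappa> \<kappa>' M. (\<And>t. (\<eta> has_real_derivative \<kappa> t) (at t)) \<Longrightarrow>
      (\<And>t. (\<kappa> has_real_derivative \<kappa>' t) (at t)) \<Longrightarrow> (\<And>k. cont_diff k \<eta>) \<Longrightarrow> continuous_on UNIV \<kappa>' \<Longrightarrow>
      (\<And>t. M \<le> t \<Longrightarrow> \<eta> t = 0) \<Longrightarrow> (\<And>t. M \<le> t \<Longrightarrow> \<kappa> t = 0) \<Longrightarrow>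
      (LINT s|lborel. (if 0 < s then s powr n * v s else 0) * (4 * s * \<kappa>' s + 4 * (n + 1) * \<kappa> s))
        = - (LINT s|lborel. W s * \<eta> s)"
begin

definition V where "V s = (if 0 < s then s powr n * v s else 0)"

lemma V0: "s \<le> 0 \<Longrightarrow> V s = 0" by (simp add: V_def)

lemma V_int': "integrable lborel (\<lambda>s. V s * indicator {..r} s)"
  unfolding V_def by (rule V_int)

lemma sW_int: "integrable lborel (\<lambda>s. s * W s * indicator {..r} s)"
proof (rule Bochner_Integration.integrable_bound)
  show "integrable lborel (\<lambda>s. r * (W s * indicator {..r} s))"
    using W_int by (rule integrable_mult_right)
  have "(\<lambda>s. s * (W s * indicator {..r} s)) \<in> borel_measurable lborel"
    using borel_measurable_integrable[OF W_int] by measurable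
  then show "(\<lambda>s. s * W s * indicator {..r} s) \<in> borel_measurable lborel"
    by (simp add: mult.assoc)
  show "AE s in lborel. norm (s * W s * indicator {..r} s) \<le> norm (r * (W s * indicator {..r} s))"
  proof (rule AE_I2)
    fix s :: real
    have "\<bar>s\<bar> * \<bar>W s\<bar> \<le> \<bar>r\<bar> * \<bar>W s\<bar>" if "0 < s" "s \<le> r"
      using that by (intro mult_right_mono) auto
    then show "norm (s * W s * indicator {..r} s) \<le> norm (r * (W s * indicator {..r} s))"
      using W0[of s] by (cases "0 < s") (auto simp: indicator_def abs_mult)
  qed
qed

text \<open>Formally the equation says \<open>4 (s\<^bsup>n+1\<^esup> v')' = - W\<close>, so \<open>4 s\<^bsup>n+1\<^esup> v'\<close> is minus the integral of \<open>W\<close>.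
  Integrating \<open>(s\<^bsup>n+1\<^esup> v)' = (n+1) V + s\<^bsup>n+1\<^esup> v'\<close> once more gives this expression for \<open>b\<^bsup>n+1\<^esup> v b\<close>,
  where the repeated integral of \<open>W\<close> is written as the integral of \<open>(b - s) W s\<close>.\<close>

definition profile_rhs where
  "profile_rhs b = (n + 1) * integral {0..b} V - (b * integral {0..b} W - integral {0..b} (\<lambda>s. s * W s)) / 4"

lemma integrable_on_V: "V integrable_on {0..b}"
  and integrable_on_W: "W integrable_on {0..b}"
  and integrable_on_sW: "(\<lambda>s. s * W s) integrable_on {0..b}"
  using lborel_integral_cutoff(1)[OF V_int' V0] lborel_integral_cutoff(1)[OF W_int W0]
    lborel_integral_cutoff(1)[OF sW_int] W0 by auto

lemma continuous_profile_rhs: "0 < b \<Longrightarrow> isCont profile_rhs b"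
proof -
  assume b: "0 < b"
  have "continuous_on {0..b+1} profile_rhs"
    unfolding profile_rhs_def
    by (intro continuous_intros indefinite_integral_continuous_1 integrable_on_V integrable_on_W integrable_on_sW) auto
  then show "isCont profile_rhs b"
    using b by (auto intro: continuous_on_interior)
qed

text \<open>The test function is \<open>\<eta> ((s - b) K) / K\<close> for large \<open>K\<close>. Its derivative approximates the indicator
  of \<open>{..b}\<close>, and the function itself approximates \<open>min (s - b) 0\<close>, so all terms except the one
  with the second derivative converge; a quarter of their sum is \<open>E k\<close>, with limit \<open>profile_rhs b\<close>.
  By the equation \<open>E k\<close> is also minus a quarter of the remaining term. This is a weighted average
  of \<open>s\<^bsup>n+1\<^esup> v s\<close> over \<open>{b..b+1/K}\<close>, because minus the second derivative is nonnegative with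
  integral \<open>1\<close>. As \<open>v\<close> is nonincreasing, the average lies between the stated bounds.\<close>

lemma approximate_identity:
  assumes b: "0 < b"
  obtains E :: "nat \<Rightarrow> real" where "E \<longlonglongrightarrow> profile_rhs b"
    "\<And>k. b powr (n + 1) * v (b + 1 / real (Suc k)) \<le> E k"
    "\<And>k. E k \<le> (b + 1 / real (Suc k)) powr (n + 1) * v b"
proof -
  obtain \<theta> \<eta> \<theta>' :: "real \<Rightarrow> real"
    where \<theta>1: "\<And>t. t \<le> 0 \<Longrightarrow> \<theta> t = 1" and \<theta>0: "\<And>t. t \<ge> 1 \<Longrightarrow> \<theta> t = 0"
    and \<theta>d: "\<And>t. (\<theta> has_real_derivative \<theta>' t) (at t)" and \<theta>'_neg: "\<And>t. \<theta>' t \<le> 0"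
    and \<eta>d: "\<And>t. (\<eta> has_real_derivative \<theta> t) (at t)" and \<eta>0: "\<And>t. t \<ge> 1 \<Longrightarrow> \<eta> t = 0"
    and \<eta>_smooth: "\<And>k. cont_diff k \<eta>" and \<theta>'_cont: "continuous_on UNIV \<theta>'"
    using smooth_cutoff_exists by metis
  have \<theta>_cont: "continuous_on UNIV \<theta>" and \<eta>_cont: "continuous_on UNIV \<eta>"
    using \<theta>d \<eta>d by (meson DERIV_isCont continuous_at_imp_continuous_on)+
  have \<theta>_mono: "\<theta> y \<le> \<theta> x" if "x \<le> y" for x y
    using that by (rule DERIV_nonpos_imp_nonincreasing) (use \<theta>d \<theta>'_neg in blast)
  have \<theta>_nonneg: "0 \<le> \<theta> t" for t using \<theta>_mono[of t "max t 1"] \<theta>0[of "max t 1"] by simp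
  have \<theta>_le1: "\<theta> t \<le> 1" for t using \<theta>_mono[of "min t 0" t] \<theta>1[of "min t 0"] by simp
  have \<theta>'0: "\<theta>' t = 0" if "t < 0 \<or> 1 < t" for t
  proof -
    have "(\<theta> has_real_derivative 0) (at t)"
    proof (cases "t < 0")
      case True
      then show ?thesis using \<theta>1
        by (intro has_field_derivative_transform_within_open[where S="{..<0}" and f="\<lambda>_. 1" and g=\<theta>]) auto
    next
      case False
      then show ?thesis using \<theta>0 that
        by (intro has_field_derivative_transform_within_open[where S="{1<..}" and f="\<lambda>_. 0" and g=\<theta>]) auto
    qed
    then show ?thesis using \<theta>d DERIV_unique by blast
  qed
  have \<eta>_mono: "\<eta> x \<le> \<eta> y" if "x \<le> y" for x y
    using that by (rule DERIV_nonneg_imp_nondecreasing) (use \<eta>d \<theta>_nonneg in blast)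
  have \<eta>_diff_mono: "\<eta> y - y \<le> \<eta> x - x" if "x \<le> y" for x y
    using that
  proof (rule DERIV_nonpos_imp_nonincreasing)
    fix t show "\<exists>d. ((\<lambda>t. \<eta> t - t) has_real_derivative d) (at t) \<and> d \<le> 0"
      using \<theta>_le1[of t] by (intro exI[of _ "\<theta> t - 1"] conjI DERIV_diff \<eta>d DERIV_ident) simp
  qed
  have \<eta>_le: "\<eta> t \<le> min t 0" for t
  proof -
    have neg: "\<eta> t - t = \<eta> 0 - 0" if t: "t < 0"
    proof -
      obtain z where "t < z" "z < 0" "(\<eta> 0 - 0) - (\<eta> t - t) = (0 - t) * (\<theta> z - 1)"
        using MVT2[OF t, of "\<lambda>t. \<eta> t - t" "\<lambda>t. \<theta> t - 1"] DERIV_diff[OF \<eta>d DERIV_ident] by blast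
      then show ?thesis using \<theta>1[of z] by simp
    qed
    have np: "\<eta> t \<le> 0" for t using \<eta>_mono[of t "max t 1"] \<eta>0[of "max t 1"] by simp
    show ?thesis
    proof (cases "t < 0")
      case True
      then show ?thesis using neg[OF True] np[of t] np[of 0] by linarith
    next
      case False
      then show ?thesis using np[of t] by simp
    qed
  qed
  have \<eta>_ge: "\<eta> 0 + min t 0 \<le> \<eta> t" for t
    using \<eta>_mono[of 0 t] \<eta>_diff_mono[of t 0] by (cases "t \<le> 0") auto
  define K where "K k = real (Suc k)" for k
  have K: "0 < K k" "1 \<le> K k" for k by (auto simp: K_def)
  define E where "E k = (n + 1) * (LINT s|lborel. V s * \<theta> ((s - b) * K k)) +
      (LINT s|lborel. W s * (\<eta> ((s - b) * K k) / K k)) / 4" for k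
  have K_lim: "(\<lambda>k. c / K k) \<longlonglongrightarrow> 0" for c
    unfolding K_def by (rule lim_const_over_n[THEN LIMSEQ_Suc])
  have lim1: "(\<lambda>k. LINT s|lborel. V s * \<theta> ((s - b) * K k)) \<longlonglongrightarrow> (LINT s|lborel. V s * indicator {..b} s)"
  proof (rule integral_dominated_convergence[where w="\<lambda>s. \<bar>V s * indicator {..b+1} s\<bar>"])
    show "integrable lborel (\<lambda>s. \<bar>V s * indicator {..b+1} s\<bar>)"
      using V_int' by (rule integrable_abs)
    show "(\<lambda>s. V s * indicator {..b} s) \<in> borel_measurable lborel"
      using V_int' by (rule borel_measurable_integrable)
    show "(\<lambda>s. V s * \<theta> ((s - b) * K k)) \<in> borel_measurable lborel" for k
    proof (rule borel_measurable_integrable, rule integrable_mult_cutoff[where r="b+1"])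
      show "continuous_on UNIV (\<lambda>s. \<theta> ((s - b) * K k))"
        by (intro continuous_on_compose2[OF \<theta>_cont] continuous_intros) auto
      show "\<theta> ((s - b) * K k) = 0" if "b + 1 < s" for s
        using that K[of k] mult_mono[of 1 "s - b" 1 "K k"] by (intro \<theta>0) auto
    qed (auto simp: V_int' V0)
    show "AE s in lborel. norm (V s * \<theta> ((s - b) * K k)) \<le> \<bar>V s * indicator {..b+1} s\<bar>" for k
    proof (rule AE_I2)
      fix s
      have "\<theta> ((s - b) * K k) = 0" if "b + 1 < s"
        using that K[of k] mult_mono[of 1 "s - b" 1 "K k"] by (intro \<theta>0) auto
      then show "norm (V s * \<theta> ((s - b) * K k)) \<le> \<bar>V s * indicator {..b+1} s\<bar>"
        using \<theta>_nonneg \<theta>_le1 by (cases "b + 1 < s") (auto simp: abs_mult mult_left_le)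
    qed
    show "AE s in lborel. (\<lambda>k. V s * \<theta> ((s - b) * K k)) \<longlonglongrightarrow> V s * indicator {..b} s"
    proof (rule AE_I2, rule tendsto_mult_left)
      fix s
      show "(\<lambda>k. \<theta> ((s - b) * K k)) \<longlonglongrightarrow> indicator {..b} s"
      proof (cases "s \<le> b")
        case True
        then have "\<theta> ((s - b) * K k) = 1" for k using K[of k] by (intro \<theta>1 mult_nonpos_nonneg) auto
        then show ?thesis using True by simp
      next
        case False
        have "eventually (\<lambda>k. 1 / K k < s - b) sequentially"
          using False by (intro order_tendstoD(2)[OF K_lim]) auto
        then have "eventually (\<lambda>k. \<theta> ((s - b) * K k) = 0) sequentially"
        proof eventually_elim
          case (elim k)
          then show ?case using K[of k] by (intro \<theta>0) (simp add: field_simps)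
        qed
        then show ?thesis using False by (simp add: tendsto_eventually)
      qed
    qed
  qed
  have \<eta>_close: "\<bar>\<eta> ((s - b) * K k) / K k - min (s - b) 0\<bar> \<le> \<bar>\<eta> 0\<bar> / K k" for s k
  proof -
    have m: "min ((s - b) * K k) 0 = min (s - b) 0 * K k"
      using K[of k] by (auto simp: min_def mult_le_0_iff zero_le_mult_iff)
    have "\<eta> ((s - b) * K k) / K k \<le> min (s - b) 0"
      using \<eta>_le[of "(s - b) * K k"] K[of k] unfolding m by (subst pos_divide_le_eq) auto
    moreover have "\<eta> 0 / K k + min (s - b) 0 \<le> \<eta> ((s - b) * K k) / K k"
    proof -
      have "(\<eta> 0 + min (s - b) 0 * K k) / K k \<le> \<eta> ((s - b) * K k) / K k"
        using \<eta>_ge[of "(s - b) * K k"] K[of k] unfolding m by (intro divide_right_mono) auto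
      then show ?thesis using K[of k] by (simp add: add_divide_distrib)
    qed
    moreover have "- (\<bar>\<eta> 0\<bar> / K k) \<le> \<eta> 0 / K k"
      using K[of k] by (simp add: divide_le_eq le_divide_eq)
    moreover have "0 \<le> \<bar>\<eta> 0\<bar> / K k" using K[of k] by simp
    ultimately show ?thesis by (intro abs_leI) linarith+
  qed
  have lim2: "(\<lambda>k. LINT s|lborel. W s * (\<eta> ((s - b) * K k) / K k)) \<longlonglongrightarrow> (LINT s|lborel. W s * min (s - b) 0)"
  proof (rule integral_dominated_convergence[where w="\<lambda>s. (\<bar>\<eta> 0\<bar> + b) * \<bar>W s * indicator {..b+1} s\<bar>"])
    show "integrable lborel (\<lambda>s. (\<bar>\<eta> 0\<bar> + b) * \<bar>W s * indicator {..b+1} s\<bar>)"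
      using W_int by (intro integrable_mult_right integrable_abs)
    have "(\<lambda>s. (W s * indicator {..b} s) * min (s - b) 0) \<in> borel_measurable lborel"
      using borel_measurable_integrable[OF W_int] by measurable
    also have "(\<lambda>s. (W s * indicator {..b} s) * min (s - b) 0) = (\<lambda>s. W s * min (s - b) 0)"
      by (auto simp: indicator_def min_def fun_eq_iff)
    finally show "(\<lambda>s. W s * min (s - b) 0) \<in> borel_measurable lborel" .
    have zero: "\<eta> ((s - b) * K k) = 0" if "b + 1 < s" for s k
      using that K[of k] mult_mono[of 1 "s - b" 1 "K k"] by (intro \<eta>0) auto
    show "(\<lambda>s. W s * (\<eta> ((s - b) * K k) / K k)) \<in> borel_measurable lborel" for k
    proof (rule borel_measurable_integrable, rule integrable_mult_cutoff[where r="b+1"])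
      show "continuous_on UNIV (\<lambda>s. \<eta> ((s - b) * K k) / K k)"
        using K[of k] by (intro continuous_on_divide continuous_on_compose2[OF \<eta>_cont] continuous_intros) auto
    qed (auto simp: W_int W0 zero)
    show "AE s in lborel. norm (W s * (\<eta> ((s - b) * K k) / K k)) \<le> (\<bar>\<eta> 0\<bar> + b) * \<bar>W s * indicator {..b+1} s\<bar>" for k
    proof (rule AE_I2)
      fix s
      consider "s \<le> 0" | "b + 1 < s" | "0 < s" "s \<le> b + 1" by linarith
      then show "norm (W s * (\<eta> ((s - b) * K k) / K k)) \<le> (\<bar>\<eta> 0\<bar> + b) * \<bar>W s * indicator {..b+1} s\<bar>"
      proof cases
        case 3
        have "\<bar>\<eta> 0\<bar> / K k \<le> \<bar>\<eta> 0\<bar> / 1" using K[of k] by (intro divide_left_mono) auto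
        moreover have "\<bar>min (s - b) 0\<bar> \<le> b" using 3 b by auto
        ultimately have "\<bar>\<eta> ((s - b) * K k) / K k\<bar> \<le> \<bar>\<eta> 0\<bar> + b"
          using \<eta>_close[of s k] by linarith
        then have "\<bar>W s\<bar> * \<bar>\<eta> ((s - b) * K k) / K k\<bar> \<le> \<bar>W s\<bar> * (\<bar>\<eta> 0\<bar> + b)"
          by (intro mult_left_mono) auto
        then show ?thesis using 3 by (simp add: abs_mult mult.commute)
      qed (use zero b W0 in auto)
    qed
    show "AE s in lborel. (\<lambda>k. W s * (\<eta> ((s - b) * K k) / K k)) \<longlonglongrightarrow> W s * min (s - b) 0"
    proof (rule AE_I2, rule tendsto_mult_left)
      fix s
      have "(\<lambda>k. \<eta> ((s - b) * K k) / K k - min (s - b) 0) \<longlonglongrightarrow> 0"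
        by (rule tendsto_rabs_zero_cancel, rule tendsto_sandwich[OF _ _ tendsto_const K_lim[of "\<bar>\<eta> 0\<bar>"]])
           (auto intro!: always_eventually \<eta>_close)
      then show "(\<lambda>k. \<eta> ((s - b) * K k) / K k) \<longlonglongrightarrow> min (s - b) 0"
        by (simp add: LIM_zero_iff)
    qed
  qed
  have W_lim: "(LINT s|lborel. W s * min (s - b) 0) = integral {0..b} (\<lambda>s. s * W s) - b * integral {0..b} W"
  proof -
    have "(LINT s|lborel. W s * min (s - b) 0) =
        (LINT s|lborel. s * W s * indicator {..b} s - b * (W s * indicator {..b} s))"
      by (intro Bochner_Integration.integral_cong) (auto simp: indicator_def min_def algebra_simps)
    also have "\<dots> = (LINT s|lborel. s * W s * indicator {..b} s) - b * (LINT s|lborel. W s * indicator {..b} s)"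
      using sW_int W_int by (subst Bochner_Integration.integral_diff) auto
    finally show ?thesis
      using lborel_integral_cutoff(2)[OF W_int W0] lborel_integral_cutoff(2)[OF sW_int] W0 by simp
  qed
  have "E \<longlonglongrightarrow> (n + 1) * (LINT s|lborel. V s * indicator {..b} s) + (LINT s|lborel. W s * min (s - b) 0) / 4"
    unfolding E_def by (intro tendsto_intros lim1 lim2) auto
  also have "(n + 1) * (LINT s|lborel. V s * indicator {..b} s) + (LINT s|lborel. W s * min (s - b) 0) / 4 = profile_rhs b"
    unfolding W_lim using lborel_integral_cutoff(2)[OF V_int' V0] by (simp add: profile_rhs_def field_simps)
  finally have E_lim: "E \<longlonglongrightarrow> profile_rhs b" .
  have bounds: "b powr (n + 1) * v (b + 1 / K k) \<le> E k \<and> E k \<le> (b + 1 / K k) powr (n + 1) * v b" for k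
  proof -
    define \<kappa> where "\<kappa> s = \<theta> ((s - b) * K k)" for s
    define \<kappa>' where "\<kappa>' s = \<theta>' ((s - b) * K k) * K k" for s
    define \<zeta> where "\<zeta> s = \<eta> ((s - b) * K k) / K k" for s
    define h where "h = 1 / K k"
    have h: "0 < h" using K[of k] by (simp add: h_def)
    have Kp: "0 < K k" by (rule K)
    have \<zeta>d: "(\<zeta> has_real_derivative \<kappa> t) (at t)" for t
      unfolding \<zeta>_def \<kappa>_def using Kp by (auto intro!: derivative_eq_intros DERIV_chain2[OF \<eta>d])
    have \<kappa>d: "(\<kappa> has_real_derivative \<kappa>' t) (at t)" for t
      unfolding \<kappa>'_def \<kappa>_def by (auto intro!: derivative_eq_intros DERIV_chain2[OF \<theta>d])
    have \<kappa>'_cont: "continuous_on UNIV \<kappa>'"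
      unfolding \<kappa>'_def by (intro continuous_intros continuous_on_compose2[OF \<theta>'_cont]) auto
    have \<kappa>_cont: "continuous_on UNIV \<kappa>"
      unfolding \<kappa>_def by (intro continuous_intros continuous_on_compose2[OF \<theta>_cont]) auto
    have \<zeta>_smooth: "cont_diff j \<zeta>" for j
    proof -
      have "cont_diff j (\<lambda>s. (s + (- b)) * K k)"
        by (intro cont_diff_mult cont_diff_add cont_diff_const cont_diff_bounded_linear bounded_linear_ident)
      from cont_diff_mult[OF cont_diff_compose[OF \<eta>_smooth this] cont_diff_const]
      have "cont_diff j (\<lambda>s. \<eta> ((s + (- b)) * K k) * (1 / K k))" .
      then show ?thesis by (simp add: \<zeta>_def[abs_def])
    qed
    have far: "1 \<le> (s - b) * K k" if "b + h \<le> s" for s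
      using that Kp by (simp add: h_def field_simps)
    have \<kappa>0: "\<kappa> s = 0" and \<zeta>0: "\<zeta> s = 0" if "b + h \<le> s" for s
      using far[OF that] by (simp_all add: \<kappa>_def \<zeta>_def \<theta>0 \<eta>0)
    have \<kappa>'0: "\<kappa>' s = 0" if "s \<notin> {b..b+h}" for s
    proof -
      have "(s - b) * K k < 0 \<or> 1 < (s - b) * K k"
        using that Kp by (auto simp: h_def field_simps mult_less_0_iff)
      then show ?thesis by (simp add: \<kappa>'_def \<theta>'0)
    qed
    have \<kappa>'_neg: "\<kappa>' s \<le> 0" for s
      unfolding \<kappa>'_def using \<theta>'_neg Kp by (intro mult_nonpos_nonneg) auto
    have i1: "integrable lborel (\<lambda>s. V s * (s * \<kappa>' s))"
    proof (rule integrable_mult_cutoff[where r="b+h"])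
      show "continuous_on UNIV (\<lambda>s. s * \<kappa>' s)"
        by (rule continuous_on_mult[OF continuous_on_id \<kappa>'_cont])
    qed (use V_int' V0 \<kappa>'0 in auto)
    have i2: "integrable lborel (\<lambda>s. V s * \<kappa> s)"
      by (rule integrable_mult_cutoff[where r="b+h"]) (use V_int' V0 \<kappa>_cont \<kappa>0 in auto)
    have "(LINT s|lborel. V s * (4 * s * \<kappa>' s + 4 * (n + 1) * \<kappa> s)) = - (LINT s|lborel. W s * \<zeta> s)"
      unfolding V_def by (rule test[OF \<zeta>d \<kappa>d \<zeta>_smooth \<kappa>'_cont \<zeta>0 \<kappa>0])
    also have "(\<lambda>s. V s * (4 * s * \<kappa>' s + 4 * (n + 1) * \<kappa> s)) =
        (\<lambda>s. 4 * (V s * (s * \<kappa>' s)) + 4 * (n + 1) * (V s * \<kappa> s))"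
      by (simp add: fun_eq_iff algebra_simps)
    also have "(LINT s|lborel. 4 * (V s * (s * \<kappa>' s)) + 4 * (n + 1) * (V s * \<kappa> s)) =
        4 * (LINT s|lborel. V s * (s * \<kappa>' s)) + 4 * (n + 1) * (LINT s|lborel. V s * \<kappa> s)"
      using i1 i2 by (subst Bochner_Integration.integral_add) (auto intro!: integrable_mult_right)
    finally have "4 * (LINT s|lborel. V s * (s * \<kappa>' s)) + 4 * ((n + 1) * (LINT s|lborel. V s * \<kappa> s)) =
        - (LINT s|lborel. W s * \<zeta> s)"
      by (simp only: mult.assoc)
    moreover have "E k = (n + 1) * (LINT s|lborel. V s * \<kappa> s) + (LINT s|lborel. W s * \<zeta> s) / 4"
      by (simp only: E_def \<kappa>_def \<zeta>_def)
    ultimately have Ek: "E k = - (LINT s|lborel. V s * (s * \<kappa>' s))"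
      by linarith
    have "has_bochner_integral lborel (\<lambda>s. - \<kappa>' s * indicator {b..b+h} s) (- \<kappa> (b+h) - - \<kappa> b)"
    proof (rule has_bochner_integral_FTC_Icc_real)
      show "isCont (\<lambda>s. - \<kappa>' s) s" for s
        using \<kappa>'_cont by (intro continuous_intros) (simp add: continuous_on_eq_continuous_at)
    qed (use h \<kappa>d in \<open>auto intro!: derivative_eq_intros\<close>)
    moreover have "- \<kappa> (b+h) - - \<kappa> b = 1" using \<kappa>0[of "b+h"] \<theta>1[of 0] by (simp add: \<kappa>_def)
    moreover have "(\<lambda>s. - \<kappa>' s * indicator {b..b+h} s) = (\<lambda>s. - \<kappa>' s)"
      using \<kappa>'0 by (auto simp: fun_eq_iff indicator_def)
    ultimately have one: "has_bochner_integral lborel (\<lambda>s. - \<kappa>' s) 1" by simp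
    have one_int: "integrable lborel (\<lambda>s. c * (- \<kappa>' s))" and one_eq: "(LINT s|lborel. c * (- \<kappa>' s)) = c" for c
      using has_bochner_integral_mult_right[of c lborel "\<lambda>s. - \<kappa>' s" 1] one
      unfolding has_bochner_integral_iff by simp_all
    have Vs: "V s * s = s powr (n + 1) * v s" if "0 < s" for s
      using that by (simp add: V_def powr_add)
    have i3: "integrable lborel (\<lambda>s. - (V s * (s * \<kappa>' s)))" using i1 by simp
    have Ek': "E k = (LINT s|lborel. - (V s * (s * \<kappa>' s)))" by (simp add: Ek)
    have pt: "b powr (n + 1) * v (b + h) * (- \<kappa>' s) \<le> - (V s * (s * \<kappa>' s)) \<and>
        - (V s * (s * \<kappa>' s)) \<le> (b + h) powr (n + 1) * v b * (- \<kappa>' s)" for s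
    proof (cases "s \<in> {b..b+h}")
      case True
      then have s: "0 < s" "b \<le> s" "s \<le> b + h" using b by auto
      have "b powr (n + 1) * v (b + h) \<le> s powr (n + 1) * v s"
        using s b n v_antimono[of s "b + h"] v_nonneg[of "b + h"] h by (intro mult_mono powr_mono2) auto
      moreover have "s powr (n + 1) * v s \<le> (b + h) powr (n + 1) * v b"
        using s b n v_antimono[of b s] v_nonneg[of s] by (intro mult_mono powr_mono2) auto
      moreover have "- (V s * (s * \<kappa>' s)) = (s powr (n + 1) * v s) * (- \<kappa>' s)"
        using Vs[OF s(1)] by (simp add: mult.assoc[symmetric])
      moreover have "0 \<le> - \<kappa>' s" using \<kappa>'_neg[of s] by simp
      ultimately show ?thesis by (metis mult_right_mono)
    next
      case False
      then show ?thesis using \<kappa>'0 by simp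
    qed
    have "(LINT s|lborel. b powr (n + 1) * v (b + h) * (- \<kappa>' s)) \<le> E k"
      unfolding Ek' using pt by (intro integral_mono one_int i3) auto
    moreover have "E k \<le> (LINT s|lborel. (b + h) powr (n + 1) * v b * (- \<kappa>' s))"
      unfolding Ek' using pt by (intro integral_mono one_int i3) auto
    ultimately show ?thesis unfolding one_eq by (simp add: h_def)
  qed
  show thesis by (rule that[OF E_lim]) (use bounds in \<open>auto simp: K_def\<close>)
qed

text \<open>The upper bound for \<open>E k\<close> passes to the limit. The lower bound involves \<open>v\<close> to the right of the
  base point, so it is used at points \<open>a < b\<close> and then \<open>a\<close> tends to \<open>b\<close>; here the continuity of
  \<open>profile_rhs\<close> replaces that of \<open>v\<close>, which is only a consequence of the identity.\<close>

theorem profile_eq: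
  assumes b: "0 < b" shows "b powr (n + 1) * v b = profile_rhs b"
proof (rule antisym)
  have h_lim: "(\<lambda>k. 1 / real (Suc k)) \<longlonglongrightarrow> 0"
    by (rule lim_const_over_n[THEN LIMSEQ_Suc])
  have upper: "profile_rhs a \<le> a powr (n + 1) * v a" if a: "0 < a" for a
  proof -
    obtain E where E: "E \<longlonglongrightarrow> profile_rhs a" "\<And>k. E k \<le> (a + 1 / real (Suc k)) powr (n + 1) * v a"
      using approximate_identity[OF a] by metis
    have "(\<lambda>k. (a + 1 / real (Suc k)) powr (n + 1) * v a) \<longlonglongrightarrow> (a + 0) powr (n + 1) * v a"
      using a by (intro tendsto_intros h_lim) auto
    then show ?thesis using E by (intro LIMSEQ_le[OF E(1)]) auto
  qed
  then show "profile_rhs b \<le> b powr (n + 1) * v b" using b .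
  have lower: "a powr (n + 1) * v b \<le> profile_rhs a" if a: "0 < a" "a < b" for a
  proof -
    obtain E where E: "E \<longlonglongrightarrow> profile_rhs a" "\<And>k. a powr (n + 1) * v (a + 1 / real (Suc k)) \<le> E k"
      using approximate_identity[OF a(1)] by metis
    have "eventually (\<lambda>k. 1 / real (Suc k) < b - a) sequentially"
      using a by (intro order_tendstoD(2)[OF h_lim]) auto
    then have "eventually (\<lambda>k. a powr (n + 1) * v b \<le> E k) sequentially"
    proof eventually_elim
      case (elim k)
      have "a powr (n + 1) * v b \<le> a powr (n + 1) * v (a + 1 / real (Suc k))"
        using elim a by (intro mult_left_mono v_antimono) (auto simp: add_pos_pos)
      then show ?case using E(2)[of k] by linarith
    qed
    then show ?thesis by (intro tendsto_lowerbound[OF E(1)]) auto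
  qed
  have "((\<lambda>a. a powr (n + 1) * v b) \<longlongrightarrow> b powr (n + 1) * v b) (at_left b)"
    using b by (intro tendsto_intros) auto
  moreover have "(profile_rhs \<longlongrightarrow> profile_rhs b) (at_left b)"
    using continuous_profile_rhs[OF b] by (simp add: isCont_def filterlim_at_split)
  moreover have "eventually (\<lambda>a. a powr (n + 1) * v b \<le> profile_rhs a) (at_left b)"
    using b lower by (auto intro!: eventually_at_leftI[of 0 b])
  ultimately show "b powr (n + 1) * v b \<le> profile_rhs b"
    by (intro tendsto_le[of "at_left b" profile_rhs "profile_rhs b" "\<lambda>a. a powr (n + 1) * v b"]) auto
qed

end

lemma DERIV_integral_from_0:
  fixes f :: "real \<Rightarrow> real"
  assumes "\<And>c. f integrable_on {0..c}" "isCont f b" "0 < b"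
  shows "((\<lambda>u. integral {0..u} f) has_real_derivative f b) (at b)"
proof -
  have "((\<lambda>u. integral {0..u} f) has_vector_derivative f b) (at b within ({0..b+1} - {}))"
    using assms(3)
    by (intro integral_has_vector_derivative_continuous_at[OF assms(1) _ finite.emptyI]
        continuous_at_imp_continuous_at_within[OF assms(2)]) simp
  moreover have "at b within ({0..b+1} - {}) = at b"
    using assms(3) by (simp add: at_within_Icc_at)
  ultimately show ?thesis by (simp add: has_real_derivative_iff_has_vector_derivative)
qed

context radial_weak_equation
begin

lemma profile_continuous:
  assumes b: "0 < b" shows "isCont v b"
proof -
  have "isCont (\<lambda>s. profile_rhs s / s powr (n + 1)) b"
    using b continuous_profile_rhs[OF b] by (intro continuous_intros) auto
  moreover have "eventually (\<lambda>s. profile_rhs s / s powr (n + 1) = v s) (nhds b)"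
    using eventually_nhds_in_open[of "{0<..}" b] b
    by (auto elim!: eventually_mono simp: profile_eq[symmetric])
  ultimately show ?thesis by (simp add: isCont_cong)
qed

text \<open>In the derivative of \<open>profile_rhs\<close> the two terms \<open>b W b\<close> cancel. What is left besides the
  multiple of \<open>V b\<close>, which accounts for the factor \<open>b\<^bsup>n+1\<^esup>\<close>, is the integral of \<open>W\<close>; it is
  differentiable in turn because \<open>W\<close> is continuous.\<close>

theorem profile_ode:
  assumes W: "\<And>s. 0 < s \<Longrightarrow> isCont W s" and b: "0 < b"
  shows "((\<lambda>u. integral {0..u} W) has_real_derivative W b) (at b)"
    and "(v has_real_derivative - integral {0..b} W * b powr (- n - 1) / 4) (at b)"
proof -
  let ?A = "\<lambda>u. integral {0..u} W"
  have V_cont: "isCont V b"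
  proof -
    have "isCont (\<lambda>s. s powr n * v s) b"
      using b profile_continuous[OF b] by (intro continuous_intros) auto
    moreover have "eventually (\<lambda>s. s powr n * v s = V s) (nhds b)"
      using eventually_nhds_in_open[of "{0<..}" b] b by (auto elim!: eventually_mono simp: V_def)
    ultimately show ?thesis by (simp add: isCont_cong)
  qed
  show dA: "(?A has_real_derivative W b) (at b)"
    by (rule DERIV_integral_from_0[OF integrable_on_W W[OF b] b])
  have dV: "((\<lambda>u. integral {0..u} V) has_real_derivative V b) (at b)"
    by (rule DERIV_integral_from_0[OF integrable_on_V V_cont b])
  have dB: "((\<lambda>u. integral {0..u} (\<lambda>s. s * W s)) has_real_derivative b * W b) (at b)"
    using W[OF b] by (intro DERIV_integral_from_0[OF integrable_on_sW _ b] continuous_intros)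
  have "(profile_rhs has_real_derivative (n + 1) * V b - (1 * ?A b + W b * b - b * W b) / 4) (at b)"
    unfolding profile_rhs_def[abs_def]
    by (intro DERIV_diff DERIV_cmult DERIV_cdivide DERIV_mult dA dV dB DERIV_ident)
  then have de: "(profile_rhs has_real_derivative (n + 1) * V b - ?A b / 4) (at b)" by simp
  have dpow: "((\<lambda>s. s powr (- n - 1)) has_real_derivative (- n - 1) * b powr (- n - 1 - 1)) (at b)"
    using b by (auto intro!: derivative_eq_intros)
  have "((\<lambda>s. profile_rhs s * s powr (- n - 1)) has_real_derivative
      ((n + 1) * V b - ?A b / 4) * b powr (- n - 1) + (- n - 1) * b powr (- n - 1 - 1) * profile_rhs b) (at b)"
    by (rule DERIV_mult[OF de dpow])
  also have "((n + 1) * V b - ?A b / 4) * b powr (- n - 1) + (- n - 1) * b powr (- n - 1 - 1) * profile_rhs b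
      = - ?A b * b powr (- n - 1) / 4"
  proof -
    have "b powr (- n - 1 - 1) * profile_rhs b = b powr (- n - 1) * V b"
      using b by (simp add: profile_eq[symmetric] V_def mult.assoc[symmetric] powr_add[symmetric])
    then have "(- n - 1) * (b powr (- n - 1 - 1) * profile_rhs b) = (- n - 1) * (b powr (- n - 1) * V b)" by simp
    then show ?thesis by (simp add: algebra_simps)
  qed
  finally show "(v has_real_derivative - ?A b * b powr (- n - 1) / 4) (at b)"
  proof (rule has_field_derivative_transform_within_open[where S="{0<..}"])
    fix s :: real assume "s \<in> {0<..}"
    then show "profile_rhs s * s powr (- n - 1) = v s"
      by (simp add: profile_eq[symmetric] mult.commute mult.assoc powr_add[symmetric])
  qed (use b in auto)
qed

end

section \<open>Asymptotics of Emden-Fowler equations\<close>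

text \<open>Two inequalities replace the equation \<open>z'' = t\<^bsup>\<gamma>-2\<^esup> z\<^bsup>q\<^esup>\<close>, because the coefficient is known only
  up to bounded factors. Sublinearity selects the solutions that do not grow with \<open>t\<close>.\<close>

locale emden_fowler =
  fixes z z1 z2 :: "real \<Rightarrow> real" and t0 \<gamma> q c1 c2 :: real
  assumes t0: "1 \<le> t0" and q: "1 < q" and c1: "0 < c1"
    and pos: "\<And>t. t0 \<le> t \<Longrightarrow> 0 < z t"
    and z_deriv: "\<And>t. t0 \<le> t \<Longrightarrow> (z has_real_derivative z1 t) (at t)"
    and z1_deriv: "\<And>t. t0 \<le> t \<Longrightarrow> (z1 has_real_derivative z2 t) (at t)"
    and z2_lower: "\<And>t. t0 \<le> t \<Longrightarrow> c1 * (t powr (\<gamma> - 2) * z t powr q) \<le> z2 t"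
    and z2_upper: "\<And>t. t0 \<le> t \<Longrightarrow> z2 t \<le> c2 * (t powr (\<gamma> - 2) * z t powr q)"
    and sublinear: "((\<lambda>t. z t / t) \<longlongrightarrow> 0) at_top"
begin

lemma c2: "0 < c2"
proof -
  have "0 < c1 * (t0 powr (\<gamma> - 2) * z t0 powr q)" using c1 t0 pos[of t0] by simp
  also have "\<dots> \<le> c2 * (t0 powr (\<gamma> - 2) * z t0 powr q)"
    using z2_lower[of t0] z2_upper[of t0] by linarith
  finally show ?thesis
    by (rule zero_less_mult_pos2) (use t0 pos[of t0] in simp)
qed

lemma z2_nonneg: "t0 \<le> t \<Longrightarrow> 0 \<le> z2 t"
  by (rule order_trans[OF _ z2_lower]) (use c1 in auto)

lemma z1_mono: "t0 \<le> s \<Longrightarrow> s \<le> t \<Longrightarrow> z1 s \<le> z1 t"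
  by (rule DERIV_nonneg_imp_nondecreasing[of s t z1])
     (assumption, meson z1_deriv z2_nonneg order_trans)

lemma mvt:
  assumes "t0 \<le> s" "s < t"
  obtains \<xi> where "s < \<xi>" "\<xi> < t" "z t - z s = (t - s) * z1 \<xi>"
  using MVT2[OF assms(2), of z z1] z_deriv assms(1) by auto

lemma z_secant_le: 
  assumes "t0 \<le> s" "s \<le> t"
  shows "z t - z s \<le> (t - s) * z1 t"
proof (cases "s = t")
  case False
  then obtain \<xi> where \<xi>: "s < \<xi>" "\<xi> < t" "z t - z s = (t - s) * z1 \<xi>"
    using mvt assms by (metis order_le_imp_less_or_eq)
  then show ?thesis using z1_mono[of \<xi> t] assms by (auto intro: mult_left_mono)
qed simp

lemma z_secant_ge: 
  assumes "t0 \<le> s" "s \<le> t"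
  shows "(t - s) * z1 s \<le> z t - z s"
proof (cases "s = t")
  case False
  then obtain \<xi> where \<xi>: "s < \<xi>" "\<xi> < t" "z t - z s = (t - s) * z1 \<xi>"
    using mvt assms by (metis order_le_imp_less_or_eq)
  then show ?thesis using z1_mono[of s \<xi>] assms by (auto intro: mult_left_mono)
qed simp

text \<open>A convex function that grows more slowly than every linear function cannot increase.\<close>

lemma z1_nonpos:
  assumes "t0 \<le> T" shows "z1 T \<le> 0"
proof (rule ccontr)
  assume "\<not> z1 T \<le> 0"
  then have e: "0 < z1 T" by simp
  have "eventually (\<lambda>t. z t / t < z1 T / 2) at_top"
    using sublinear e by (intro order_tendstoD(2)) auto
  then obtain A where A: "\<And>t. A \<le> t \<Longrightarrow> z t / t < z1 T / 2"
    by (auto simp: eventually_at_top_linorder)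
  define t where "t = max A (2 * T)"
  have t: "A \<le> t" "2 * T \<le> t" "0 < t" "T \<le> t" using assms t0 by (auto simp: t_def)
  have "(t / 2) * z1 T \<le> (t - T) * z1 T"
    using t e by (intro mult_right_mono) auto
  also have "\<dots> \<le> z t - z T" using z_secant_ge[of T t] assms t by simp
  also have "\<dots> < z t" using pos[OF assms] by simp
  finally show False using A[OF t(1)] t(3) by (simp add: field_simps)
qed

lemma z_antimono:
  assumes "t0 \<le> s" "s \<le> t" shows "z t \<le> z s"
proof -
  have "(t - s) * z1 t \<le> 0"
    using z1_nonpos[of t] assms by (intro mult_nonneg_nonpos) auto
  then show ?thesis using z_secant_le[OF assms] by simp
qed

text \<open>If the slope stayed below \<open>- e\<close>, the positive function \<open>z\<close> would become negative.\<close>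

lemma z1_gt_neg:
  assumes "t0 \<le> t" "0 < e"
  obtains T where "t \<le> T" "- e < z1 T"
proof (rule ccontr)
  assume "\<not> thesis"
  with that have *: "z1 T \<le> - e" if "t \<le> T" for T using \<open>t \<le> T\<close> not_le by blast
  define T where "T = t + z t / e"
  have T: "t \<le> T" using pos[OF assms(1)] assms(2) by (simp add: T_def)
  have "z T - z t \<le> (T - t) * z1 T" using z_secant_le[of t T] assms(1) T by simp
  also have "\<dots> \<le> (T - t) * (- e)" using *[OF T] T by (intro mult_left_mono) auto
  also have "\<dots> = - z t" using assms(2) by (simp add: T_def)
  finally have "z T \<le> 0" by simp
  then show False using pos[of T] assms(1) T by simp
qed

text \<open>Formally \<open>- z1 t\<close> is the integral of \<open>z2\<close> over \<open>{t..}\<close>, because \<open>z1\<close> tends to \<open>0\<close>. Monotonicity of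
  \<open>z1 s + B s\<^sup>a\<close> expresses this without an improper integral.\<close>

lemma neg_z1_le:
  assumes t: "t0 \<le> t" and a: "a < 0" and B: "0 \<le> B"
    and bound: "\<And>s. t \<le> s \<Longrightarrow> z2 s \<le> B * (- a) * s powr (a - 1)"
  shows "- z1 t \<le> B * t powr a"
proof (rule field_le_epsilon)
  fix e :: real assume "0 < e"
  with t obtain T where T: "t \<le> T" "- e < z1 T" by (rule z1_gt_neg)
  have "z1 T + B * T powr a \<le> z1 t + B * t powr a"
  proof (rule DERIV_nonpos_imp_nonincreasing[OF T(1)])
    fix s assume s: "t \<le> s" "s \<le> T"
    have "((\<lambda>s. z1 s + B * s powr a) has_real_derivative z2 s + B * (a * s powr (a - 1))) (at s)"
      using s t t0 by (auto intro!: derivative_eq_intros z1_deriv)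
    moreover have "z2 s + B * (a * s powr (a - 1)) \<le> 0"
      using bound[OF s(1)] by (simp add: algebra_simps)
    ultimately show "\<exists>y. ((\<lambda>s. z1 s + B * s powr a) has_real_derivative y) (at s) \<and> y \<le> 0"
      by blast
  qed
  moreover have "0 \<le> B * T powr a" using B by simp
  ultimately show "- z1 t \<le> B * t powr a + e" using T(2) by linarith
qed

lemma z1_increment:
  assumes "t0 \<le> s" "s < t" 
  obtains \<xi> where "s < \<xi>" "\<xi> < t" "z1 t - z1 s = (t - s) * z2 \<xi>"
  using MVT2[OF assms(2), of z1 z2] z1_deriv assms(1) by auto

text \<open>The power that linearises the first order equation \<open>- z' = t\<^bsup>\<gamma>-1\<^esup> z\<^bsup>q\<^esup>\<close>.\<close>

lemma z_powr_deriv: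
  assumes "t0 \<le> t"
  shows "((\<lambda>t. z t powr (1 - q)) has_real_derivative ((q - 1) * (- z1 t) / z t powr q)) (at t)"
proof -
  have "((\<lambda>t. z t powr (1 - q)) has_real_derivative ((1 - q) * z t powr (1 - q - 1) * z1 t)) (at t)"
    using DERIV_fun_powr[OF z_deriv[OF assms] pos[OF assms], of "1 - q"] by (simp add: mult_ac)
  moreover have "z t powr (1 - q - 1) = 1 / z t powr q"
    by (simp add: powr_minus_divide)
  ultimately show ?thesis by (simp add: algebra_simps diff_divide_distrib)
qed

lemma z_eq_powr:
  assumes "t0 \<le> t" shows "z t = (z t powr (1 - q)) powr (- 1 / (q - 1))"
proof -
  have "(1 - q) * (- 1 / (q - 1)) = 1" using q by (simp add: field_simps)
  then show ?thesis using pos[OF assms] by (simp add: powr_powr del: times_divide_eq_right)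
qed

lemma le_of_powr_ge:
  assumes "t0 \<le> t" "0 < D" "D \<le> z t powr (1 - q)"
  shows "z t \<le> D powr (- 1 / (q - 1))"
proof -
  have "(z t powr (1 - q)) powr (- 1 / (q - 1)) \<le> D powr (- 1 / (q - 1))"
    using assms q by (intro powr_mono2') auto
  then show ?thesis using z_eq_powr[OF assms(1)] by simp
qed

lemma ge_of_powr_le:
  assumes "t0 \<le> t" "z t powr (1 - q) \<le> D"
  shows "D powr (- 1 / (q - 1)) \<le> z t"
proof -
  have "D powr (- 1 / (q - 1)) \<le> (z t powr (1 - q)) powr (- 1 / (q - 1))"
    using assms q pos[OF assms(1)] by (intro powr_mono2') auto
  then show ?thesis using z_eq_powr[OF assms(1)] by simp
qed

lemma neg_z1_le_powr:
  assumes t: "t0 \<le> t" and g: "\<gamma> < 1"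
  shows "- z1 t \<le> c2 / (1 - \<gamma>) * z t powr q * t powr (\<gamma> - 1)"
proof (rule neg_z1_le[OF t])
  fix s assume s: "t \<le> s"
  have "z s powr q \<le> z t powr q"
    using z_antimono[OF t s] pos[of s] t s q by (intro powr_mono2) auto
  then have "c2 * (s powr (\<gamma> - 2) * z s powr q) \<le> c2 * (s powr (\<gamma> - 2) * z t powr q)"
    using c2 by (intro mult_left_mono) auto
  also have "\<dots> = c2 / (1 - \<gamma>) * z t powr q * - (\<gamma> - 1) * s powr (\<gamma> - 1 - 1)"
    using g by (simp add: field_simps)
  finally show "z2 s \<le> c2 / (1 - \<gamma>) * z t powr q * - (\<gamma> - 1) * s powr (\<gamma> - 1 - 1)"
    using z2_upper[of s] t s by linarith
qed (use g c2 in auto)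

text \<open>Because \<open>z\<close> is nonincreasing, integrating the upper bound for \<open>z2\<close> gives the first order inequality
  \<open>- z1 \<le> C t\<^bsup>\<gamma>-1\<^esup> z\<^bsup>q\<^esup>\<close>, and thus a bound on the growth of \<open>z\<^bsup>1-q\<^esup>\<close>, that is, a lower bound for \<open>z\<close>.
  For \<open>\<gamma> \<le> 0\<close> it has the
  right order of magnitude.\<close>

lemma powr_growth_le:
  assumes t: "t0 \<le> t" and g: "\<gamma> < 1"
    and F: "\<And>s. t0 \<le> s \<Longrightarrow> (F has_real_derivative s powr (\<gamma> - 1)) (at s)"
  shows "z t powr (1 - q) - z t0 powr (1 - q) \<le> (q - 1) * c2 / (1 - \<gamma>) * (F t - F t0)"
proof -
  let ?K = "(q - 1) * c2 / (1 - \<gamma>)"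
  have "z t powr (1 - q) - ?K * F t \<le> z t0 powr (1 - q) - ?K * F t0"
  proof (rule DERIV_nonpos_imp_nonincreasing[OF t])
    fix s assume s: "t0 \<le> s" "s \<le> t"
    have d: "((\<lambda>s. z s powr (1 - q) - ?K * F s) has_real_derivative
        ((q - 1) * (- z1 s) / z s powr q) - ?K * s powr (\<gamma> - 1)) (at s)"
      by (intro DERIV_diff z_powr_deriv DERIV_cmult F s)
    have "- z1 s / z s powr q \<le> c2 / (1 - \<gamma>) * s powr (\<gamma> - 1)"
      using neg_z1_le_powr[OF s(1) g] pos[OF s(1)] by (subst pos_divide_le_eq) (auto simp: mult_ac)
    then have "(q - 1) * (- z1 s / z s powr q) \<le> (q - 1) * (c2 / (1 - \<gamma>) * s powr (\<gamma> - 1))"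
      using q by (intro mult_left_mono) auto
    then have "(q - 1) * (- z1 s) / z s powr q \<le> ?K * s powr (\<gamma> - 1)"
      by (simp add: mult_ac)
    then have "(q - 1) * (- z1 s) / z s powr q - ?K * s powr (\<gamma> - 1) \<le> 0" by simp
    with d show "\<exists>y. ((\<lambda>s. z s powr (1 - q) - ?K * F s) has_real_derivative y) (at s) \<and> y \<le> 0"
      by (intro exI conjI)
  qed
  then show ?thesis by (simp add: right_diff_distrib)
qed

text \<open>The growth of \<open>z\<^bsup>1-q\<^esup>\<close> is at most that of \<open>t\<^bsup>\<gamma>\<^esup> / \<gamma>\<close>, which is bounded for \<open>\<gamma> < 0\<close>.\<close>

theorem asymp_neg:
  assumes g: "\<gamma> < 0"
  obtains c C where "0 < c" "\<And>t. t0 \<le> t \<Longrightarrow> c \<le> z t \<and> z t \<le> C"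
proof
  let ?K = "(q - 1) * c2 / (1 - \<gamma>)"
  define D where "D = z t0 powr (1 - q) - ?K * (t0 powr \<gamma> / \<gamma>)"
  have K: "0 \<le> ?K" using q c2 g by simp
  have D: "0 < D"
  proof -
    have "?K * (t0 powr \<gamma> / \<gamma>) \<le> 0"
      using K g by (intro mult_nonneg_nonpos) (auto simp: divide_nonneg_neg)
    moreover have "0 < z t0 powr (1 - q)" using pos[of t0] by simp
    ultimately show ?thesis unfolding D_def by linarith
  qed
  then show "0 < D powr (- 1 / (q - 1))" by simp
  fix t assume t: "t0 \<le> t"
  have "z t powr (1 - q) - z t0 powr (1 - q) \<le> ?K * (t powr \<gamma> / \<gamma> - t0 powr \<gamma> / \<gamma>)"
    using g t0 by (intro powr_growth_le t) (auto intro!: derivative_eq_intros)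
  also have "\<dots> \<le> ?K * (0 - t0 powr \<gamma> / \<gamma>)"
    using K g by (intro mult_left_mono diff_right_mono) (auto simp: divide_nonneg_neg)
  finally have "z t powr (1 - q) \<le> D" by (simp add: D_def)
  then show "D powr (- 1 / (q - 1)) \<le> z t \<and> z t \<le> z t0"
    using ge_of_powr_le[OF t] z_antimono[OF _ t] by simp
qed

text \<open>Integrating the lower bound for \<open>z2\<close> over \<open>{t..2t}\<close> bounds \<open>- z1 t\<close> from below in terms of
  \<open>z (2 t)\<close>. If this value is less than half of \<open>z t\<close>, convexity shows that \<open>- z1 t\<close> exceeds
  \<open>z t / (2 t)\<close>, which is at least a constant times \<open>z\<^bsup>q\<^esup> / t\<close> since \<open>z\<close> is bounded and \<open>q > 1\<close>.\<close>

lemma neg_z1_ge_critical: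
  assumes g: "\<gamma> = 0"
  obtains c where "0 < c" "\<And>t. t0 \<le> t \<Longrightarrow> c * z t powr q / t \<le> - z1 t"
proof
  let ?c = "min (c1 / 4 * (1/2) powr q) (1 / (2 * z t0 powr (q - 1)))"
  show "0 < ?c" using c1 pos[of t0] by simp
  fix t assume t: "t0 \<le> t"
  have tp: "0 < t" using t t0 by simp
  have zp: "0 < z t" using pos[OF t] .
  show "?c * z t powr q / t \<le> - z1 t"
  proof (cases "z t / 2 \<le> z (2 * t)")
    case True
    have "t0 \<le> t" "t < 2 * t" using t tp by auto
    then obtain \<xi> where \<xi>: "t < \<xi>" "\<xi> < 2 * t" "z1 (2 * t) - z1 t = (2 * t - t) * z2 \<xi>"
      by (rule z1_increment)
    have "z t / 2 \<le> z \<xi>" using True z_antimono[of \<xi> "2 * t"] \<xi> t by simp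
    then have "(z t / 2) powr q \<le> z \<xi> powr q" using zp q by (intro powr_mono2) auto
    moreover have "(2 * t) powr (- 2) \<le> \<xi> powr (- 2)"
      using \<xi> tp by (intro powr_mono2') auto
    ultimately have "c1 * ((2 * t) powr (-2) * (z t / 2) powr q) \<le> c1 * (\<xi> powr (- 2) * z \<xi> powr q)"
      using c1 by (intro mult_left_mono mult_mono) auto
    also have "\<dots> \<le> z2 \<xi>" using z2_lower[of \<xi>] \<xi> t g by simp
    finally have "t * (c1 * ((2 * t) powr (-2) * (z t / 2) powr q)) \<le> t * z2 \<xi>"
      using tp by (intro mult_left_mono) auto
    also have "t * z2 \<xi> = z1 (2 * t) - z1 t" using \<xi>(3) by simp
    also have "\<dots> \<le> - z1 t" using z1_nonpos[of "2 * t"] t tp by simp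
    also have "t * (c1 * ((2 * t) powr (-2) * (z t / 2) powr q)) =
        c1 / 4 * (1/2) powr q * (z t powr q / t)"
      using tp zp by (simp add: powr_minus_divide powr_mult powr_divide power2_eq_square field_simps)
    finally have "c1 / 4 * (1/2) powr q * (z t powr q / t) \<le> - z1 t" .
    moreover have "?c * (z t powr q / t) \<le> c1 / 4 * (1/2) powr q * (z t powr q / t)"
      using tp by (intro mult_right_mono) auto
    ultimately show ?thesis by simp
  next
    case False
    have "z (2 * t) - z t \<ge> t * z1 t" using z_secant_ge[of t "2 * t"] t tp by simp
    then have A: "z t / (2 * t) \<le> - z1 t" using False tp by (simp add: field_simps)
    have "z t powr (q - 1) \<le> z t0 powr (q - 1)"
      using z_antimono[of t0 t] t zp q by (intro powr_mono2) auto
    then have "z t powr (q - 1) * z t \<le> z t0 powr (q - 1) * z t"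
      using zp by (intro mult_right_mono) auto
    moreover have "z t powr (q - 1) * z t = z t powr q"
      using zp by (simp add: powr_diff)
    ultimately have "z t powr q / (2 * z t0 powr (q - 1)) / t \<le> z t / (2 * t)"
      using tp pos[of t0] by (simp add: field_simps)
    moreover have "?c * (z t powr q / t) \<le> 1 / (2 * z t0 powr (q - 1)) * (z t powr q / t)"
      using tp by (intro mult_right_mono) auto
    ultimately show ?thesis using A by simp
  qed
qed

text \<open>Both inequalities \<open>- z1 \<sim> z\<^bsup>q\<^esup> / t\<close> hold, so \<open>z\<^bsup>1-q\<^esup>\<close> grows like \<open>ln t\<close>.\<close>

theorem asymp_critical:
  assumes g: "\<gamma> = 0"
  obtains c C T where "0 < c" "1 < T"
    "\<And>t. T \<le> t \<Longrightarrow> c * ln t powr (- 1 / (q - 1)) \<le> z t \<and> z t \<le> C * ln t powr (- 1 / (q - 1))"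
proof -
  obtain c where c: "0 < c" and cle: "\<And>t. t0 \<le> t \<Longrightarrow> c * z t powr q / t \<le> - z1 t"
    using neg_z1_ge_critical[OF g] by blast
  let ?T = "max (t0\<^sup>2) 3"
  let ?P = "\<lambda>t. z t powr (1 - q)"
  define D where "D = ?P t0 + (q - 1) * c2"
  define d where "d = (q - 1) * c / 2"
  have d: "0 < d" using c q by (simp add: d_def)
  have D: "0 < D" using pos[of t0] q c2 by (auto simp: D_def intro!: add_pos_nonneg)
  have "D powr (- 1 / (q - 1)) * ln t powr (- 1 / (q - 1)) \<le> z t \<and>
        z t \<le> d powr (- 1 / (q - 1)) * ln t powr (- 1 / (q - 1))" if t: "?T \<le> t" for t
  proof -
    have "t0 \<le> t0\<^sup>2" using t0 by (simp add: power2_eq_square)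
    then have tt: "t0 \<le> t" "t0\<^sup>2 \<le> t" "3 \<le> t" using t by auto
    have ln1: "1 \<le> ln t"
    proof -
      have "exp 1 \<le> t" using exp_le tt by linarith
      then show ?thesis using tt by (simp add: ln_ge_iff)
    qed
    have ln0: "0 \<le> ln t0" using t0 by simp
    have "2 * ln t0 = ln (t0\<^sup>2)" using t0 by (simp add: ln_realpow)
    also have "\<dots> \<le> ln t" using tt t0 by (intro ln_mono) auto
    finally have ln2: "2 * ln t0 \<le> ln t" .
    have lnd: "(ln has_real_derivative s powr (\<gamma> - 1)) (at s)" if "t0 \<le> s" for s
      using that t0 g by (auto intro!: derivative_eq_intros simp: powr_minus_divide)
    have "?P t - ?P t0 \<le> (q - 1) * c2 / (1 - \<gamma>) * (ln t - ln t0)"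
      using g by (intro powr_growth_le tt lnd) auto
    also have "\<dots> \<le> (q - 1) * c2 * ln t"
      using g q c2 ln0 by (auto intro!: mult_left_mono)
    finally have "?P t \<le> ?P t0 * 1 + (q - 1) * c2 * ln t" by simp
    also have "\<dots> \<le> D * ln t"
      unfolding D_def distrib_right using ln1 by (intro add_right_mono mult_left_mono) auto
    finally have low: "(D * ln t) powr (- 1 / (q - 1)) \<le> z t" by (rule ge_of_powr_le[OF tt(1)])
    have "?P t0 - (q - 1) * c * ln t0 \<le> ?P t - (q - 1) * c * ln t"
    proof (rule DERIV_nonneg_imp_nondecreasing[OF tt(1)])
      fix s assume s: "t0 \<le> s" "s \<le> t"
      have dd: "((\<lambda>s. ?P s - (q - 1) * c * ln s) has_real_derivative
          ((q - 1) * (- z1 s) / z s powr q) - (q - 1) * c * s powr (\<gamma> - 1)) (at s)"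
        by (intro DERIV_diff z_powr_deriv DERIV_cmult lnd s)
      have "(q - 1) * (c * z s powr q / s) \<le> (q - 1) * (- z1 s)"
        using cle[OF s(1)] q by (intro mult_left_mono) auto
      moreover have "s powr (\<gamma> - 1) = 1 / s" using s t0 g by (simp add: powr_minus_divide)
      ultimately have "(q - 1) * c * s powr (\<gamma> - 1) \<le> (q - 1) * (- z1 s) / z s powr q"
        using pos[OF s(1)] by (subst pos_le_divide_eq) (auto simp: mult_ac)
      then have "0 \<le> (q - 1) * (- z1 s) / z s powr q - (q - 1) * c * s powr (\<gamma> - 1)" by simp
      with dd show "\<exists>y. ((\<lambda>s. ?P s - (q - 1) * c * ln s) has_real_derivative y) (at s) \<and> 0 \<le> y"
        by (intro exI conjI)
    qed
    moreover have "0 \<le> ?P t0" by simp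
    moreover have "(q - 1) * c * (2 * ln t0) \<le> (q - 1) * c * ln t"
      using ln2 q c by (intro mult_left_mono) auto
    moreover have "d * ln t = ((q - 1) * c * ln t) / 2" by (simp add: d_def)
    ultimately have "d * ln t \<le> ?P t" by linarith
    then have "z t \<le> (d * ln t) powr (- 1 / (q - 1))"
      using d ln1 by (intro le_of_powr_ge tt) auto
    then show ?thesis using low D d ln1 by (simp add: powr_mult)
  qed
  then show thesis using D by (intro that[of "D powr (- 1 / (q - 1))" ?T]) auto
qed

text \<open>A Keller--Osserman type bound by iteration. Convexity and the lower bound for \<open>z2\<close> on \<open>{2t..4t}\<close>
  give \<open>a t\<^sup>\<gamma> z(4t)\<^sup>q \<le> z t\<close>; for the rescaled function \<open>m t = z t t\<^sup>\<delta>\<close>, where \<open>\<delta> = \<gamma> / (q - 1)\<close>,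
  this reads \<open>m(4t)\<^sup>q \<le> K m t\<close>. Since \<open>q > 1\<close>, every sufficiently large bound for \<open>m\<close> on
  one block between consecutive powers of \<open>4\<close> is inherited by the next.\<close>

lemma rescaled_bounded:
  assumes g: "0 < \<gamma>"
  obtains B where "0 < B" "\<And>t. t0 \<le> t \<Longrightarrow> z t * t powr (\<gamma> / (q - 1)) \<le> B"
proof -
  define \<delta> where "\<delta> = \<gamma> / (q - 1)"
  have \<delta>: "0 < \<delta>" "\<delta> * q = \<gamma> + \<delta>" using g q by (auto simp: \<delta>_def field_simps)
  define m where "m t = z t * t powr \<delta>" for t
  \<comment> \<open>The minimum covers both signs of \<open>\<gamma> - 2\<close> in bounding \<open>\<xi> powr (\<gamma> - 2)\<close> on {2 t..4 t}.\<close>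
  define a where "a = 2 * c1 * min (2 powr (\<gamma> - 2)) (4 powr (\<gamma> - 2))"
  have a: "0 < a" using c1 by (simp add: a_def)
  have step: "a * t powr \<gamma> * z (4 * t) powr q \<le> z t" if t: "t0 \<le> t" for t
  proof -
    have tp: "0 < t" using t t0 by simp
    have "t0 \<le> 2 * t" "2 * t < 4 * t" using t tp by auto
    then obtain \<xi> where \<xi>: "2 * t < \<xi>" "\<xi> < 4 * t" "z1 (4 * t) - z1 (2 * t) = (4 * t - 2 * t) * z2 \<xi>"
      by (rule z1_increment)
    have "min (2 powr (\<gamma> - 2)) (4 powr (\<gamma> - 2)) * t powr (\<gamma> - 2) \<le> \<xi> powr (\<gamma> - 2)"
    proof (cases "2 \<le> \<gamma>")
      case True
      then have "(2 * t) powr (\<gamma> - 2) \<le> \<xi> powr (\<gamma> - 2)"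
        using \<xi> tp by (intro powr_mono2) auto
      then have le: "2 powr (\<gamma> - 2) * t powr (\<gamma> - 2) \<le> \<xi> powr (\<gamma> - 2)"
        using tp by (simp add: powr_mult)
      show ?thesis by (rule order_trans[OF mult_right_mono le]) auto
    next
      case False
      then have "(4 * t) powr (\<gamma> - 2) \<le> \<xi> powr (\<gamma> - 2)"
        using \<xi> tp by (intro powr_mono2') auto
      then have le: "4 powr (\<gamma> - 2) * t powr (\<gamma> - 2) \<le> \<xi> powr (\<gamma> - 2)"
        using tp by (simp add: powr_mult)
      show ?thesis by (rule order_trans[OF mult_right_mono le]) auto
    qed
    moreover have "z (4 * t) powr q \<le> z \<xi> powr q"
      using z_antimono[of \<xi> "4 * t"] pos[of "4 * t"] \<xi> t tp q by (intro powr_mono2) auto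
    ultimately have "c1 * (min (2 powr (\<gamma> - 2)) (4 powr (\<gamma> - 2)) * t powr (\<gamma> - 2) * z (4 * t) powr q)
        \<le> c1 * (\<xi> powr (\<gamma> - 2) * z \<xi> powr q)"
      using c1 by (intro mult_left_mono mult_mono) auto
    also have "\<dots> \<le> z2 \<xi>" using z2_lower[of \<xi>] \<xi> t tp by simp
    finally have "2 * t * (c1 * (min (2 powr (\<gamma> - 2)) (4 powr (\<gamma> - 2)) * t powr (\<gamma> - 2) * z (4 * t) powr q))
        \<le> 2 * t * z2 \<xi>"
      using tp by (intro mult_left_mono) auto
    also have "\<dots> = z1 (4 * t) - z1 (2 * t)" using \<xi>(3) by simp
    also have "\<dots> \<le> - z1 (2 * t)" using z1_nonpos[of "4 * t"] t tp by simp
    finally have "t * (2 * t * (c1 * (min (2 powr (\<gamma> - 2)) (4 powr (\<gamma> - 2)) * t powr (\<gamma> - 2) * z (4 * t) powr q)))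
        \<le> t * (- z1 (2 * t))"
      using tp by (intro mult_left_mono) auto
    also have "\<dots> \<le> z t - z (2 * t)" using z_secant_le[of t "2 * t"] t tp by simp
    also have "\<dots> \<le> z t" using pos[of "2 * t"] t tp by simp
    also have "t * (2 * t * (c1 * (min (2 powr (\<gamma> - 2)) (4 powr (\<gamma> - 2)) * t powr (\<gamma> - 2) * z (4 * t) powr q))) =
        a * (t\<^sup>2 * t powr (\<gamma> - 2)) * z (4 * t) powr q"
      by (simp add: a_def power2_eq_square mult_ac)
    also have "t\<^sup>2 * t powr (\<gamma> - 2) = t powr \<gamma>"
      using tp by (simp add: powr_diff)
    finally show ?thesis .
  qed
  define K where "K = 4 powr (\<delta> * q) / a"
  have K: "0 < K" using a by (simp add: K_def)
  have iter: "m (4 * t) powr q \<le> K * m t" if t: "t0 \<le> t" for t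
  proof -
    have tp: "0 < t" using t t0 by simp
    have "m (4 * t) powr q = z (4 * t) powr q * (4 powr (\<delta> * q) * (t powr \<gamma> * t powr \<delta>))"
      using tp pos[of "4 * t"] t by (simp add: m_def powr_mult powr_powr \<delta>(2) powr_add)
    also have "\<dots> = K * t powr \<delta> * (a * t powr \<gamma> * z (4 * t) powr q)"
      using a by (simp add: K_def)
    also have "\<dots> \<le> K * t powr \<delta> * z t"
      using step[OF t] K by (intro mult_left_mono) auto
    finally show ?thesis by (simp add: m_def mult_ac)
  qed
  define B where "B = max (z t0 * (4 * t0) powr \<delta>) (K powr (1 / (q - 1)))"
  have B: "0 < B" using K by (auto simp: B_def less_max_iff_disj)
  have "K = (K powr (1 / (q - 1))) powr (q - 1)" using K q by (simp add: powr_powr)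
  also have "\<dots> \<le> B powr (q - 1)" using q by (intro powr_mono2) (auto simp: B_def)
  finally have "K * B \<le> B powr (q - 1) * B" using B by (intro mult_right_mono) auto
  also have "\<dots> = B powr q" using B by (simp add: powr_diff)
  finally have KB: "K * B \<le> B powr q" .
  have bound: "m t \<le> B" if "t0 \<le> t" "t \<le> 4 ^ j * (4 * t0)" for t j
    using that
  proof (induction j arbitrary: t)
    case 0
    have "m t \<le> z t0 * (4 * t0) powr \<delta>"
      unfolding m_def using 0 t0 \<delta> z_antimono[of t0 t] pos[of t0]
      by (intro mult_mono powr_mono2) auto
    then show ?case by (simp add: B_def)
  next
    case (Suc j)
    show ?case
    proof (cases "t \<le> 4 * t0")
      case True
      have "m t \<le> z t0 * (4 * t0) powr \<delta>"
        unfolding m_def using Suc.prems True t0 \<delta> z_antimono[of t0 t] pos[of t0]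
        by (intro mult_mono powr_mono2) auto
      then show ?thesis by (simp add: B_def)
    next
      case False
      have t4: "t0 \<le> t / 4" using False by simp
      have "m (4 * (t / 4)) powr q \<le> K * m (t / 4)" by (rule iter[OF t4])
      also have "\<dots> \<le> K * B"
        using Suc.IH[of "t / 4"] Suc.prems t4 K by (intro mult_left_mono) auto
      also have "\<dots> \<le> B powr q" by (rule KB)
      finally have le: "m t powr q \<le> B powr q" by simp
      show ?thesis
      proof (rule ccontr)
        assume "\<not> m t \<le> B"
        then have "B powr q < m t powr q" using B q by (intro powr_less_mono2) auto
        with le show False by simp
      qed
    qed
  qed
  have "m t \<le> B" if t: "t0 \<le> t" for t
  proof -
    obtain j where "t < 4 ^ j" using real_arch_pow[of 4 t] by auto
    also have "4 ^ j * 1 \<le> (4 ^ j * (4 * t0) :: real)" using t0 by (intro mult_left_mono) auto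
    finally show ?thesis using bound[OF t, of j] by simp
  qed
  then show thesis using B that by (simp add: m_def \<delta>_def)
qed

text \<open>For the lower bound, let \<open>m t = z t t\<^sup>\<delta>\<close> as before. The upper bound for \<open>z\<close> makes \<open>z2\<close> at most
  \<open>E z / t\<^sup>2\<close>, hence \<open>- z1 \<le> E z / t\<close>. If moreover \<open>m t\<close> is small, then \<open>z2\<close> is small compared with
  \<open>z / t\<^sup>2\<close> on the long interval \<open>{t..M t}\<close>, and \<open>- z1 (M t)\<close> is small because of the factor \<open>1 / M\<close>;
  together \<open>- t z1 t \<le> \<delta> z t\<close>, which means \<open>m' t \<ge> 0\<close>. So \<open>m\<close> cannot descend below the smaller of
  this threshold and its initial value.\<close>

theorem asymp_pos:
  assumes g: "0 < \<gamma>"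
  obtains c C where "0 < c"
    "\<And>t. t0 \<le> t \<Longrightarrow> c * t powr (- (\<gamma> / (q - 1))) \<le> z t \<and> z t \<le> C * t powr (- (\<gamma> / (q - 1)))"
proof -
  define \<delta> where "\<delta> = \<gamma> / (q - 1)"
  have \<delta>: "0 < \<delta>" "\<delta> * (q - 1) = \<gamma>" using g q by (auto simp: \<delta>_def)
  define m where "m t = z t * t powr \<delta>" for t
  obtain B where B: "0 < B" "\<And>t. t0 \<le> t \<Longrightarrow> m t \<le> B"
    using rescaled_bounded[OF g] by (auto simp: m_def \<delta>_def)
  have mpos: "0 < m t" if "t0 \<le> t" for t using pos[OF that] that t0 by (simp add: m_def)
  have z2m: "z2 t \<le> c2 * (m t powr (q - 1) * z t * t powr (- 2))" if t: "t0 \<le> t" for t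
  proof -
    have tp: "0 < t" using t t0 by simp
    have "m t powr (q - 1) * z t * t powr (- 2) = (z t powr (q - 1) * z t) * (t powr \<gamma> * t powr (-2))"
      using tp pos[OF t] by (simp add: m_def powr_mult powr_powr \<delta>(2))
    also have "z t powr (q - 1) * z t = z t powr q" using pos[OF t] by (simp add: powr_diff)
    also have "t powr \<gamma> * t powr (-2) = t powr (\<gamma> - 2)" by (simp add: powr_add[symmetric])
    finally show ?thesis using z2_upper[OF t] by (simp add: mult.commute)
  qed
  define E where "E = c2 * B powr (q - 1)"
  have E: "0 < E" using c2 B by (simp add: E_def)
  have z1E: "- z1 t \<le> E * z t / t" if t: "t0 \<le> t" for t
  proof -
    have "- z1 t \<le> E * z t * t powr (- 1)"
    proof (rule neg_z1_le[OF t])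
      fix s assume s: "t \<le> s"
      have "m s powr (q - 1) \<le> B powr (q - 1)"
        using B(2)[of s] mpos[of s] s t q by (intro powr_mono2) auto
      then have "c2 * (m s powr (q - 1) * z s * s powr (- 2)) \<le> c2 * (B powr (q - 1) * z t * s powr (- 2))"
        using z_antimono[OF t s] pos[of s] c2 s t by (intro mult_left_mono mult_mono mult_right_mono) auto
      then show "z2 s \<le> E * z t * - (- 1) * s powr (- 1 - 1)"
        using z2m[of s] s t by (simp add: E_def mult_ac)
    qed (use E pos[OF t] in auto)
    then show ?thesis using t t0 by (simp add: powr_minus_divide)
  qed
  \<comment> \<open>M makes the contribution of z1 at M t at most half of the allowed drift, and the threshold
    \<open>\<mu>\<close> does the same for the integral of z2 over {t..M t}.\<close>
  define M where "M = max 2 (2 * E / \<delta>)"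
  have M: "2 \<le> M" "E / M \<le> \<delta> / 2"
  proof -
    show M2: "2 \<le> M" by (simp add: M_def)
    have "2 * E / \<delta> \<le> M" by (simp add: M_def)
    then show "E / M \<le> \<delta> / 2" using \<delta> M2 by (simp add: field_simps)
  qed
  define \<mu> where "\<mu> = (\<delta> / (2 * c2 * M powr (1 + \<gamma>))) powr (1 / (q - 1))"
  have \<mu>: "0 < \<mu>" using \<delta> c2 M by (simp add: \<mu>_def)
  have \<mu>_powr: "\<mu> powr (q - 1) = \<delta> / (2 * c2 * M powr (1 + \<gamma>))"
    using \<delta> c2 M q by (simp add: \<mu>_def powr_powr)
  have drift: "- z1 t \<le> \<delta> * z t / t" if t: "t0 \<le> t" and small: "m t \<le> \<mu>" for t
  proof -
    have tp: "0 < t" using t t0 by simp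
    have Mt: "2 * t \<le> M * t" using M tp by (intro mult_right_mono) auto
    have "t < M * t" using Mt tp by linarith
    with t obtain \<xi> where \<xi>: "t < \<xi>" "\<xi> < M * t" "z1 (M * t) - z1 t = (M * t - t) * z2 \<xi>"
      by (rule z1_increment)
    have "m \<xi> \<le> z t * (M * t) powr \<delta>"
      unfolding m_def using z_antimono[of t \<xi>] pos[OF t] \<xi> t tp \<delta> by (intro mult_mono powr_mono2) auto
    also have "\<dots> = M powr \<delta> * m t" using M tp by (simp add: powr_mult m_def)
    finally have "m \<xi> powr (q - 1) \<le> (M powr \<delta> * m t) powr (q - 1)"
      using mpos[of \<xi>] \<xi> t q by (intro powr_mono2) auto
    also have "\<dots> = M powr \<gamma> * m t powr (q - 1)"
      using M mpos[OF t] by (simp add: powr_mult powr_powr \<delta>(2))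
    also have "\<dots> \<le> M powr \<gamma> * \<mu> powr (q - 1)"
      using small mpos[OF t] q by (intro mult_left_mono powr_mono2) auto
    also have "\<dots> = \<delta> / (2 * c2 * M)"
      using M c2 by (simp add: \<mu>_powr powr_add field_simps)
    finally have m\<xi>: "m \<xi> powr (q - 1) \<le> \<delta> / (2 * c2 * M)" .
    have "z2 \<xi> \<le> c2 * (m \<xi> powr (q - 1) * z \<xi> * \<xi> powr (- 2))" using z2m[of \<xi>] \<xi> t by simp
    also have "\<dots> \<le> c2 * (\<delta> / (2 * c2 * M) * z t * t powr (- 2))"
    proof (intro mult_left_mono mult_mono m\<xi>)
      show "\<xi> powr (- 2) \<le> t powr (- 2)" using \<xi> tp by (intro powr_mono2') auto
    qed (use z_antimono[of t \<xi>] pos[of \<xi>] pos[OF t] \<xi> t c2 M \<delta> in auto)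
    also have "\<dots> = \<delta> / (2 * M) * z t / t\<^sup>2"
      using c2 tp by (simp add: powr_minus_divide)
    finally have "(M * t - t) * z2 \<xi> \<le> (M * t) * (\<delta> / (2 * M) * z t / t\<^sup>2)"
      using Mt tp \<xi> t z2_nonneg[of \<xi>] by (intro mult_mono) auto
    also have "\<dots> = \<delta> / 2 * (z t / t)" using M tp by (simp add: power2_eq_square)
    finally have A: "z1 (M * t) - z1 t \<le> \<delta> / 2 * (z t / t)" using \<xi>(3) by simp
    have "- z1 (M * t) \<le> E * z (M * t) / (M * t)" using Mt t tp by (intro z1E) linarith
    also have "\<dots> = (E / M) * (z (M * t) / t)" by simp
    also have "\<dots> \<le> (\<delta> / 2) * (z t / t)"
      using M(2) z_antimono[of t "M * t"] pos[of "M * t"] t tp Mt \<delta>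
      by (intro mult_mono divide_right_mono) auto
    finally show ?thesis using A by simp
  qed
  define l where "l = min (m t0) \<mu>"
  have l: "0 < l" using mpos[of t0] \<mu> by (simp add: l_def)
  have m_deriv: "(m has_real_derivative t powr (\<delta> - 1) * (t * z1 t + \<delta> * z t)) (at t)" if "t0 \<le> t" for t
  proof -
    have tp: "0 < t" using that t0 by simp
    have "(m has_real_derivative z1 t * t powr \<delta> + \<delta> * t powr (\<delta> - 1) * z t) (at t)"
      unfolding m_def using tp by (auto intro!: derivative_eq_intros z_deriv[OF that])
    moreover have "t powr \<delta> = t powr (\<delta> - 1) * t" using tp by (simp add: powr_diff)
    ultimately show ?thesis by (simp add: algebra_simps)
  qed
  have low: "l \<le> m t" if t: "t0 \<le> t" for t
  proof (rule ccontr)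
    assume neg: "\<not> l \<le> m t"
    \<comment> \<open>After the last time in S the function m stays below the threshold, where it cannot decrease.\<close>
    define S where "S = {s \<in> {t0..t}. l \<le> m s}"
    have cont: "continuous_on {t0..t} m"
      using m_deriv by (meson DERIV_isCont atLeastAtMost_iff continuous_at_imp_continuous_on)
    have "closed S"
      unfolding S_def using continuous_on_closed_Collect_le[OF continuous_on_const cont] by simp
    moreover have "t0 \<in> S" using t by (auto simp: S_def l_def)
    moreover have "bdd_above S" by (auto simp: S_def)
    ultimately have sup: "Sup S \<in> S" by (intro closed_contains_Sup) auto
    have above: "s \<le> Sup S" if "s \<in> S" for s
      using that \<open>bdd_above S\<close> by (rule cSup_upper)
    have s0: "t0 \<le> Sup S" "l \<le> m (Sup S)" "Sup S < t"
      using sup neg by (auto simp: S_def order_le_less)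
    obtain \<xi> where \<xi>: "Sup S < \<xi>" "\<xi> < t"
      "m t - m (Sup S) = (t - Sup S) * (\<xi> powr (\<delta> - 1) * (\<xi> * z1 \<xi> + \<delta> * z \<xi>))"
      using MVT2[OF s0(3), of m "\<lambda>t. t powr (\<delta> - 1) * (t * z1 t + \<delta> * z t)"] m_deriv s0(1)
      by auto
    have "m \<xi> < l"
    proof (rule ccontr)
      assume "\<not> m \<xi> < l"
      then have "\<xi> \<in> S" using \<xi> s0 by (simp add: S_def)
      then show False using above \<xi>(1) by force
    qed
    then have "- z1 \<xi> \<le> \<delta> * z \<xi> / \<xi>" using drift[of \<xi>] \<xi> s0 by (simp add: l_def)
    then have "0 \<le> \<xi> * z1 \<xi> + \<delta> * z \<xi>" using \<xi> s0 t0 by (simp add: field_simps)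
    then have "0 \<le> m t - m (Sup S)" unfolding \<xi>(3) using s0 by simp
    then show False using s0 neg by linarith
  qed
  show thesis
  proof (rule that[OF l])
    fix t assume t: "t0 \<le> t"
    have "0 < t" using t t0 by simp
    then show "l * t powr (- (\<gamma> / (q - 1))) \<le> z t \<and> z t \<le> B * t powr (- (\<gamma> / (q - 1)))"
      using low[OF t] B(2)[OF t] by (simp add: \<delta>_def[symmetric] m_def powr_minus_divide field_simps)
  qed
qed

end

section \<open>The profile in the harmonic variable\<close>

lemma filterlim_powr_at_top:
  fixes m :: real
  assumes "0 < m"
  shows "filterlim (\<lambda>x. x powr m) at_top at_top"
proof -
  have "filterlim (\<lambda>x. exp (m * ln x)) at_top at_top"
    using assms
    by (intro filterlim_compose[OF exp_at_top] filterlim_tendsto_pos_mult_at_top[OF tendsto_const _ ln_at_top])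
  then show ?thesis
    by (rule filterlim_mono_eventually)
      (auto simp: powr_def intro: eventually_mono[OF eventually_gt_at_top[of 0]])
qed

text \<open>The new variable is \<open>t = s\<^sup>n\<close>, that is \<open>|x|\<^bsup>N-2\<^esup>\<close> for \<open>s = |x|\<^sup>2\<close>, and \<open>z t = t v s\<close>. For
  large \<open>s\<close> the weighted right-hand side \<open>W\<close> is negative, so that \<open>A\<close> decreases. If \<open>v\<close> stayed
  above a positive constant, \<open>- W\<close> would be at least of order \<open>s\<^bsup>n-b1/2\<^esup>\<close>, whose integral diverges,
  so \<open>A\<close> would become negative and \<open>v\<close> would increase. Therefore \<open>v\<close> tends to \<open>0\<close>, which is
  the sublinearity of \<open>z\<close>.\<close>

lemma emden_fowler_of_radial_ode:
  fixes v A W :: "real \<Rightarrow> real" and n b1 b2 p1 p2 :: real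
  assumes n: "0 < n" and b1: "b1 < 2" and b12: "b1 < b2" and p: "2 < p1" "p1 < p2"
    and v_pos: "\<And>s. 0 < s \<Longrightarrow> 0 < v s"
    and v_antimono: "\<And>s t. 0 < s \<Longrightarrow> s \<le> t \<Longrightarrow> v t \<le> v s"
    and dA: "\<And>s. 0 < s \<Longrightarrow> (A has_real_derivative W s) (at s)"
    and dv: "\<And>s. 0 < s \<Longrightarrow> (v has_real_derivative - A s * s powr (- n - 1) / 4) (at s)"
    and W: "\<And>s. 0 < s \<Longrightarrow> W s = s powr n * (s powr (- b2 / 2) * v s powr (p2 - 1) - s powr (- b1 / 2) * v s powr (p1 - 1))"
  obtains t0 where "emden_fowler (\<lambda>t. t * v (t powr (1 / n)))
     (\<lambda>t. v (t powr (1 / n)) - A (t powr (1 / n)) / (4 * n * t))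
     (\<lambda>t. - (t powr (1 / n) * W (t powr (1 / n))) / (4 * n\<^sup>2 * t\<^sup>2))
     t0 (2 - p1 + (2 - b1) / (2 * n)) (p1 - 1) (1 / (8 * n\<^sup>2)) (1 / (4 * n\<^sup>2))"
proof -
  have "((\<lambda>s. s powr ((b1 - b2) / 2) * v 1 powr (p2 - p1)) \<longlongrightarrow> 0 * v 1 powr (p2 - p1)) at_top"
    using b12 by (intro tendsto_mult_right tendsto_neg_powr filterlim_ident) auto
  then have "eventually (\<lambda>s. s powr ((b1 - b2) / 2) * v 1 powr (p2 - p1) < 1 / 2) at_top"
    by (intro order_tendstoD(2)) auto
  then obtain s1 where s1: "\<And>s. s1 \<le> s \<Longrightarrow> s powr ((b1 - b2) / 2) * v 1 powr (p2 - p1) < 1 / 2"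
    by (auto simp: eventually_at_top_linorder)
  \<comment> \<open>Beyond s0 the power with exponent p2 is at most half of the other one.\<close>
  define s0 where "s0 = max 1 s1"
  have s0: "1 \<le> s0" by (simp add: s0_def)
  define D where "D s = s powr (n - b1 / 2) * v s powr (p1 - 1)" for s
  have WD: "D s / 2 \<le> - W s \<and> - W s \<le> D s" if s: "s0 \<le> s" for s
  proof -
    have sp: "1 \<le> s" "s1 \<le> s" using s by (auto simp: s0_def)
    define x where "x = s powr ((b1 - b2) / 2) * v s powr (p2 - p1)"
    have "x \<le> s powr ((b1 - b2) / 2) * v 1 powr (p2 - p1)"
      unfolding x_def using v_antimono[of 1 s] v_pos[of s] sp p by (intro mult_left_mono powr_mono2) auto
    then have x: "0 \<le> x" "x \<le> 1 / 2" using s1[OF sp(2)] by (auto simp: x_def)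
    have "s powr n * (s powr (- b2 / 2) * v s powr (p2 - 1)) = D s * x"
    proof -
      have "D s * x = (s powr (n - b1 / 2) * s powr ((b1 - b2) / 2)) * (v s powr (p1 - 1) * v s powr (p2 - p1))"
        by (simp add: D_def x_def mult_ac)
      also have "\<dots> = s powr (n + - b2 / 2) * v s powr (p2 - 1)"
        by (simp add: powr_add[symmetric] diff_divide_distrib)
      finally have "D s * x = s powr (n + - b2 / 2) * v s powr (p2 - 1)" .
      then show ?thesis by (simp only: powr_add mult.assoc)
    qed
    moreover have "s powr n * (s powr (- b1 / 2) * v s powr (p1 - 1)) = D s"
      by (simp add: D_def mult.assoc[symmetric] powr_add[symmetric])
    ultimately have "- W s = D s - D s * x"
      using W[of s] sp by (simp add: right_diff_distrib)
    moreover have D0: "0 \<le> D s" by (simp add: D_def)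
    moreover have "0 \<le> D s * x" "D s * x \<le> D s * (1 / 2)"
      using mult_nonneg_nonneg[OF D0 x(1)] mult_left_mono[OF x(2) D0] by simp_all
    ultimately show ?thesis by linarith
  qed
  have v_lim: "(v \<longlongrightarrow> 0) at_top"
  proof (rule tendstoI)
    fix \<epsilon> :: real assume \<epsilon>: "0 < \<epsilon>"
    have "\<exists>s>0. v s < \<epsilon>"
    proof (rule ccontr)
      assume "\<not> (\<exists>s>0. v s < \<epsilon>)"
      then have ge: "\<epsilon> \<le> v s" if "0 < s" for s using that by force
      \<comment> \<open>The exponent of the primitive of s powr (n - b1 / 2); it is positive because b1 < 2.\<close>
      define m where "m = n - b1 / 2 + 1"
      have m: "0 < m" using n b1 by (simp add: m_def)
      define c where "c = \<epsilon> powr (p1 - 1) / (2 * m)"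
      have c: "0 < c" using \<epsilon> m by (simp add: c_def)
      have A_le: "A s + c * s powr m \<le> A s0 + c * s0 powr m" if s: "s0 \<le> s" for s
      proof (rule DERIV_nonpos_imp_nonincreasing[OF s])
        fix r assume r: "s0 \<le> r" "r \<le> s"
        have "((\<lambda>s. A s + c * s powr m) has_real_derivative W r + c * (m * r powr (m - 1))) (at r)"
          using r s0 by (auto intro!: derivative_eq_intros dA)
        moreover have "c * (m * r powr (m - 1)) \<le> D r / 2"
        proof -
          have "\<epsilon> powr (p1 - 1) \<le> v r powr (p1 - 1)"
            using ge[of r] \<epsilon> r s0 p by (intro powr_mono2) auto
          then have "r powr (n - b1 / 2) * \<epsilon> powr (p1 - 1) \<le> D r"
            unfolding D_def by (intro mult_left_mono) auto
          moreover have "m - 1 = n - b1 / 2" by (simp add: m_def)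
          moreover have cm: "c * (m * y) = y * \<epsilon> powr (p1 - 1) / 2" for y
            using m by (simp add: c_def)
          ultimately show ?thesis unfolding cm by simp
        qed
        then have "W r + c * (m * r powr (m - 1)) \<le> 0" using WD[OF r(1)] by linarith
        ultimately show "\<exists>y. ((\<lambda>s. A s + c * s powr m) has_real_derivative y) (at r) \<and> y \<le> 0"
          by (intro exI conjI)
      qed
      have "filterlim (\<lambda>s. c * s powr m) at_top at_top"
        using c m by (intro filterlim_tendsto_pos_mult_at_top[OF tendsto_const] filterlim_powr_at_top) auto
      then have "eventually (\<lambda>s. A s0 + c * s0 powr m < c * s powr m) at_top"
        by (simp add: filterlim_at_top_dense)
      then obtain s2 where s2: "\<And>s. s2 \<le> s \<Longrightarrow> A s0 + c * s0 powr m < c * s powr m"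
        by (auto simp: eventually_at_top_linorder)
      define s where "s = max s0 s2"
      have s: "0 < s" "s0 \<le> s" "s2 \<le> s" using s0 by (auto simp: s_def)
      have "A s < 0" using A_le[OF s(2)] s2[OF s(3)] by linarith
      then have "0 < - A s * s powr (- n - 1) / 4" using s by (simp add: zero_less_mult_iff mult_neg_pos)
      from DERIV_pos_inc_right[OF dv[OF s(1)] this]
      obtain d where "0 < d" "\<And>h. 0 < h \<Longrightarrow> h < d \<Longrightarrow> v s < v (s + h)" by blast
      then have "v s < v (s + d / 2)" by simp
      moreover have "v (s + d / 2) \<le> v s" using s \<open>0 < d\<close> by (intro v_antimono) auto
      ultimately show False by simp
    qed
    then obtain s where s: "0 < s" "v s < \<epsilon>" by blast
    show "eventually (\<lambda>t. dist (v t) 0 < \<epsilon>) at_top"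
      using eventually_ge_at_top[of s]
    proof eventually_elim
      case (elim t)
      then show ?case using v_antimono[OF s(1) elim] v_pos[of t] s by simp
    qed
  qed
  define t0 where "t0 = s0 powr n"
  have t0: "1 \<le> t0" using s0 n by (simp add: t0_def ge_one_powr_ge_zero)
  show thesis
  proof (rule that[of t0], unfold_locales)
    show "1 \<le> t0" "1 < p1 - 1" "0 < 1 / (8 * n\<^sup>2)" using t0 p n by auto
    fix t assume t: "t0 \<le> t"
    define s where "s = t powr (1 / n)"
    have tp: "0 < t" using t t0 by simp
    have sp: "0 < s" using tp by (simp add: s_def)
    have tn: "t = s powr n" using tp n by (simp add: s_def powr_powr)
    have s0s: "s0 \<le> s"
    proof -
      have "s0 = t0 powr (1 / n)" using s0 n by (simp add: t0_def powr_powr)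
      also have "\<dots> \<le> s" unfolding s_def using t t0 n by (intro powr_mono2) auto
      finally show ?thesis .
    qed
    show "0 < t * v (t powr (1 / n))" using tp v_pos[OF sp] by (simp add: s_def)
    have ds: "((\<lambda>t. t powr (1 / n)) has_real_derivative s / (n * t)) (at t)"
      using tp n by (auto intro!: derivative_eq_intros simp: s_def powr_diff)
    have dvs: "((\<lambda>t. v (t powr (1 / n))) has_real_derivative - A s / (4 * n * t\<^sup>2)) (at t)"
    proof -
      have "((\<lambda>t. v (t powr (1 / n))) has_real_derivative
          (- A s * s powr (- n - 1) / 4) * (s / (n * t))) (at t)"
        using dv[OF sp] ds unfolding s_def by (rule DERIV_chain2)
      moreover have "s powr (- n - 1) * s = 1 / t"
        using sp by (simp add: tn powr_diff powr_minus_divide)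
      then have "(- A s * s powr (- n - 1) / 4) * (s / (n * t)) = - A s / (4 * n * t\<^sup>2)"
        using tp n by (simp add: field_simps power2_eq_square)
      ultimately show ?thesis by simp
    qed
    have dAs: "((\<lambda>t. A (t powr (1 / n))) has_real_derivative W s * (s / (n * t))) (at t)"
      using dA[OF sp] ds unfolding s_def by (rule DERIV_chain2)
    have "((\<lambda>t. t * v (t powr (1 / n))) has_real_derivative 1 * v s + (- A s / (4 * n * t\<^sup>2)) * t) (at t)"
      using DERIV_mult[OF DERIV_ident dvs] by (simp add: s_def)
    then show "((\<lambda>t. t * v (t powr (1 / n))) has_real_derivative
        v (t powr (1 / n)) - A (t powr (1 / n)) / (4 * n * t)) (at t)"
      using tp by (simp add: s_def power2_eq_square mult.assoc)
    have dq: "((\<lambda>t. A (t powr (1 / n)) / (4 * n * t)) has_real_derivative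
        (W s * (s / (n * t)) * (4 * n * t) - A s * (4 * n)) / ((4 * n * t) * (4 * n * t))) (at t)"
      unfolding s_def using tp n
      by (intro DERIV_divide dAs[unfolded s_def]) (auto intro!: derivative_eq_intros)
    have "((\<lambda>t. v (t powr (1 / n)) - A (t powr (1 / n)) / (4 * n * t)) has_real_derivative
        - A s / (4 * n * t\<^sup>2) - (W s * (s / (n * t)) * (4 * n * t) - A s * (4 * n)) / ((4 * n * t) * (4 * n * t))) (at t)"
      by (rule DERIV_diff[OF dvs dq])
    also have "- A s / (4 * n * t\<^sup>2) - (W s * (s / (n * t)) * (4 * n * t) - A s * (4 * n)) / ((4 * n * t) * (4 * n * t))
        = - (s * W s) / (4 * n\<^sup>2 * t\<^sup>2)"
      using tp n by (simp add: field_simps power2_eq_square)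
    finally show "((\<lambda>t. v (t powr (1 / n)) - A (t powr (1 / n)) / (4 * n * t)) has_real_derivative
        - (t powr (1 / n) * W (t powr (1 / n))) / (4 * n\<^sup>2 * t\<^sup>2)) (at t)"
      by (simp only: s_def)
    have sD: "s * D s / t\<^sup>2 = t powr (2 - p1 + (2 - b1) / (2 * n) - 2) * (t * v s) powr (p1 - 1)"
    proof -
      have "s * D s / t\<^sup>2 = (s powr 1 * s powr (n - b1 / 2)) * s powr (- 2 * n) * v s powr (p1 - 1)"
        using sp by (simp add: D_def tn powr_power powr_minus_divide mult.commute)
      also have "\<dots> = s powr (1 + (n - b1 / 2) + - 2 * n) * v s powr (p1 - 1)"
        by (simp only: powr_add)
      also have "1 + (n - b1 / 2) + - 2 * n = n * (2 - p1 + (2 - b1) / (2 * n) - 2) + n * (p1 - 1)"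
        using n by (simp add: field_simps)
      also have "s powr (n * (2 - p1 + (2 - b1) / (2 * n) - 2) + n * (p1 - 1)) * v s powr (p1 - 1) =
          t powr (2 - p1 + (2 - b1) / (2 * n) - 2) * (t * v s) powr (p1 - 1)"
        using sp v_pos[OF sp] by (simp add: tn powr_add powr_powr powr_mult)
      finally show ?thesis .
    qed
    have pos: "0 < s / (4 * n\<^sup>2 * t\<^sup>2)" using sp n tp by simp
    have "(s / (4 * n\<^sup>2 * t\<^sup>2)) * (D s / 2) \<le> (s / (4 * n\<^sup>2 * t\<^sup>2)) * (- W s)"
      "(s / (4 * n\<^sup>2 * t\<^sup>2)) * (- W s) \<le> (s / (4 * n\<^sup>2 * t\<^sup>2)) * D s"
      by (rule mult_left_mono[OF _ less_imp_le[OF pos]], use WD[OF s0s] in blast)+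
    moreover have "(s / (4 * n\<^sup>2 * t\<^sup>2)) * (D s / 2) = 1 / (8 * n\<^sup>2) * (s * D s / t\<^sup>2)"
      "(s / (4 * n\<^sup>2 * t\<^sup>2)) * D s = 1 / (4 * n\<^sup>2) * (s * D s / t\<^sup>2)"
      "(s / (4 * n\<^sup>2 * t\<^sup>2)) * (- W s) = - (s * W s) / (4 * n\<^sup>2 * t\<^sup>2)"
      by simp_all
    ultimately show "1 / (8 * n\<^sup>2) * (t powr (2 - p1 + (2 - b1) / (2 * n) - 2) * (t * v (t powr (1 / n))) powr (p1 - 1))
        \<le> - (t powr (1 / n) * W (t powr (1 / n))) / (4 * n\<^sup>2 * t\<^sup>2)"
      "- (t powr (1 / n) * W (t powr (1 / n))) / (4 * n\<^sup>2 * t\<^sup>2)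
        \<le> 1 / (4 * n\<^sup>2) * (t powr (2 - p1 + (2 - b1) / (2 * n) - 2) * (t * v (t powr (1 / n))) powr (p1 - 1))"
      unfolding sD by (simp_all only: s_def)
  next
    have "((\<lambda>t. v (t powr (1 / n))) \<longlongrightarrow> 0) at_top"
      using n by (intro filterlim_compose[OF v_lim] filterlim_powr_at_top) auto
    moreover have "eventually (\<lambda>t. v (t powr (1 / n)) = t * v (t powr (1 / n)) / t) at_top"
      using eventually_gt_at_top[of 0] by eventually_elim simp
    ultimately show "((\<lambda>t. t * v (t powr (1 / n)) / t) \<longlongrightarrow> 0) at_top"
      by (rule Lim_transform_eventually)
  qed
qed

section \<open>Decay of radial solutions\<close>

text \<open>Local integrability across the origin in space is integrability with the weight \<open>s powr (N/2 - 1)\<close>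
  up to \<open>s = 0\<close>.\<close>

lemma integrable_radial_profile:
  fixes u :: "'a::euclidean_space \<Rightarrow> real"
  assumes loc: "locally_integrable u" and u: "\<And>x. u x = g (x \<bullet> x)"
    and g [measurable]: "g \<in> borel_measurable borel"
  shows "integrable lborel
    (\<lambda>s. (if 0 < s then s powr (real DIM('a) / 2 - 1) * g s else 0) * indicator {..r} s)"
proof -
  let ?C = "real DIM('a) / 2 * unit_ball_vol (real DIM('a))"
  have "0 < ?C" by simp
  then have C: "?C \<noteq> 0" by (rule less_imp_neq[THEN not_sym])
  have "integrable lebesgue (\<lambda>x. indicator (cball 0 (sqrt \<bar>r\<bar>)) x *\<^sub>R u x)"
    using loc unfolding locally_integrable_def set_integrable_def by auto
  also have "(\<lambda>x. indicator (cball 0 (sqrt \<bar>r\<bar>)) x *\<^sub>R u x) =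
      (\<lambda>x. g (x \<bullet> x) * indicator {..\<bar>r\<bar>} (x \<bullet> x))"
    by (auto simp: fun_eq_iff u indicator_def norm_eq_sqrt_inner)
  finally have "integrable lborel (\<lambda>s. radial_density DIM('a) s * (g s * indicator {..\<bar>r\<bar>} s))"
    by (subst (asm) lebesgue_integral_radial(1)[of "\<lambda>s. g s * indicator {..\<bar>r\<bar>} s"]) auto
  then have "integrable lborel (\<lambda>s. (1 / ?C) *
      (radial_density DIM('a) s * (g s * indicator {..\<bar>r\<bar>} s) * indicator {..r} s))"
    by (intro integrable_mult_right integrable_real_mult_indicator) auto
  also have "(\<lambda>s. (1 / ?C) * (radial_density DIM('a) s * (g s * indicator {..\<bar>r\<bar>} s) * indicator {..r} s)) =
      (\<lambda>s. (if 0 < s then s powr (real DIM('a) / 2 - 1) * g s else 0) * indicator {..r} s)"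
    using C by (auto simp: fun_eq_iff radial_density_def indicator_def)
  finally show ?thesis .
qed

text \<open>The value at \<open>0\<close> is exempt from monotonicity, since a profile may be singular there while its
  value at the origin is arbitrary.\<close>

lemma borel_measurable_nonincreasing_profile:
  fixes v :: "real \<Rightarrow> real"
  assumes mono: "\<And>s t. 0 < s \<Longrightarrow> s \<le> t \<Longrightarrow> v t \<le> v s" and neg: "\<And>s. s < 0 \<Longrightarrow> v s = 0"
  shows "v \<in> borel_measurable borel"
proof -
  have "mono_on {0<..} (\<lambda>s. - v s)" using mono by (auto simp: mono_on_def)
  then have "(\<lambda>s. - v s) \<in> borel_measurable (restrict_space borel {0<..})"
    by (rule borel_measurable_mono_on_fnc)
  then have "(\<lambda>s. - (- v s)) \<in> borel_measurable (restrict_space borel {0<..})"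
    by (rule borel_measurable_uminus)
  then have [measurable]: "(\<lambda>s. v s * indicator {0<..} s) \<in> borel_measurable borel"
    by (subst (asm) borel_measurable_restrict_space_iff) (auto simp: mult.commute)
  have "(\<lambda>s. v s * indicator {0<..} s + v 0 * indicator {0} s) \<in> borel_measurable borel"
    by measurable
  also have "(\<lambda>s. v s * indicator {0<..} s + v 0 * indicator {0} s) = v"
    using neg by (auto simp: fun_eq_iff indicator_def not_less order_le_less)
  finally show ?thesis .
qed

lemma radial_weak_equation_of_weak_solution:
  fixes u f :: "'a::euclidean_space \<Rightarrow> real"
  assumes ws: "weak_solution u f"
    and u: "\<And>x. u x = v (x \<bullet> x)" and f: "\<And>x. f x = F (x \<bullet> x)"
    and v [measurable]: "v \<in> borel_measurable borel" and F [measurable]: "F \<in> borel_measurable borel"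
    and v_nonneg: "\<And>s. 0 < s \<Longrightarrow> 0 \<le> v s"
    and v_antimono: "\<And>s t. 0 < s \<Longrightarrow> s \<le> t \<Longrightarrow> v t \<le> v s"
  shows "radial_weak_equation (real DIM('a) / 2 - 1) v
    (\<lambda>s. if 0 < s then s powr (real DIM('a) / 2 - 1) * F s else 0)"
proof
  let ?n = "real DIM('a) / 2 - 1"
  let ?C = "real DIM('a) / 2 * unit_ball_vol (real DIM('a))"
  have "0 < ?C" by simp
  then have C: "?C \<noteq> 0" by (rule less_imp_neq[THEN not_sym])
  have ul: "locally_integrable u" and fl: "locally_integrable f"
    using ws by (auto simp: weak_solution_def weak_gradient_def)
  show "- 1 < ?n" by simp
  show "integrable lborel (\<lambda>s. (if 0 < s then s powr ?n * v s else 0) * indicator {..r} s)" for r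
    by (rule integrable_radial_profile[OF ul u v])
  show "integrable lborel (\<lambda>s. (if 0 < s then s powr ?n * F s else 0) * indicator {..r} s)" for r
    by (rule integrable_radial_profile[OF fl f F])
  fix \<eta> \<kappa> \<kappa>' :: "real \<Rightarrow> real" and M :: real
  assume *: "\<And>t. (\<eta> has_real_derivative \<kappa> t) (at t)" "\<And>t. (\<kappa> has_real_derivative \<kappa>' t) (at t)"
    "\<And>k. cont_diff k \<eta>" "continuous_on UNIV \<kappa>'" "\<And>t. M \<le> t \<Longrightarrow> \<eta> t = 0" "\<And>t. M \<le> t \<Longrightarrow> \<kappa> t = 0"
  have "continuous_on UNIV \<eta>" "continuous_on UNIV \<kappa>"
    using *(1,2) by (meson DERIV_isCont continuous_at_imp_continuous_on)+
  then have [measurable]: "\<eta> \<in> borel_measurable borel" "\<kappa> \<in> borel_measurable borel" "\<kappa>' \<in> borel_measurable borel"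
    using *(4) by (auto intro: borel_measurable_continuous_onI)
  define g1 where "g1 s = v s * (4 * s * \<kappa>' s + 2 * real DIM('a) * \<kappa> s)" for s
  define g2 where "g2 s = F s * \<eta> s" for s
  have [measurable]: "g1 \<in> borel_measurable borel" "g2 \<in> borel_measurable borel"
    unfolding g1_def g2_def by measurable
  have pull: "(LINT s|lborel. radial_density DIM('a) s * g s) =
      ?C * (LINT s|lborel. (if 0 < s then s powr ?n * g s else 0))" for g
  proof -
    have "(LINT s|lborel. radial_density DIM('a) s * g s) =
        (LINT s|lborel. ?C * (if 0 < s then s powr ?n * g s else 0))"
      by (intro Bochner_Integration.integral_cong) (auto simp: radial_density_def)
    then show ?thesis by simp
  qed
  have "(LINT x|lebesgue. g1 ((x::'a) \<bullet> x)) = - (LINT x|lebesgue. g2 ((x::'a) \<bullet> x))"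
    using weak_solution_radial_test[OF ws *] by (simp add: g1_def g2_def u f)
  then have "?C * (LINT s|lborel. (if 0 < s then s powr ?n * g1 s else 0)) =
      ?C * - (LINT s|lborel. (if 0 < s then s powr ?n * g2 s else 0))"
    by (simp add: lebesgue_integral_radial(2) pull)
  then have "(LINT s|lborel. (if 0 < s then s powr ?n * g1 s else 0)) =
      - (LINT s|lborel. (if 0 < s then s powr ?n * g2 s else 0))"
    using C by (simp only: mult_cancel_left simp_thms)
  moreover have "(\<lambda>s. if 0 < s then s powr ?n * g1 s else 0) =
      (\<lambda>s. (if 0 < s then s powr ?n * v s else 0) * (4 * s * \<kappa>' s + 4 * (?n + 1) * \<kappa> s))"
    by (auto simp: fun_eq_iff g1_def)
  moreover have "(\<lambda>s. if 0 < s then s powr ?n * g2 s else 0) =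
      (\<lambda>s. (if 0 < s then s powr ?n * F s else 0) * \<eta> s)"
    by (auto simp: fun_eq_iff g2_def)
  ultimately show "(LINT s|lborel. (if 0 < s then s powr ?n * v s else 0) * (4 * s * \<kappa>' s + 4 * (?n + 1) * \<kappa> s)) =
      - (LINT s|lborel. (if 0 < s then s powr ?n * F s else 0) * \<eta> s)"
    by simp
qed (use v_nonneg v_antimono in auto)

lemma comparable_at_infinityI:
  fixes f g :: "'a::euclidean_space \<Rightarrow> real"
  assumes "0 < c" "0 < R"
    and "\<And>x. R \<le> norm x \<Longrightarrow> 0 \<le> g x \<and> c * g x \<le> f x \<and> f x \<le> C * g x"
  shows "comparable_at_infinity f g"
  unfolding comparable_at_infinity_def
proof (rule exI[of _ c], rule exI[of _ "max c C"], rule exI[of _ R], intro conjI allI impI)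
  fix x :: 'a assume x: "R \<le> norm x"
  have "C * g x \<le> max c C * g x" using assms(3)[OF x] by (intro mult_right_mono) auto
  then show "f x \<le> max c C * g x" using assms(3)[OF x] by linarith
qed (use assms in auto)

lemma norm_powr_even:
  fixes x :: "'a::euclidean_space"
  shows "norm x powr b = (x \<bullet> x) powr (b / 2)"
proof -
  have "norm x = (x \<bullet> x) powr (1 / 2)" by (simp add: norm_eq_sqrt_inner powr_half_sqrt)
  then show ?thesis by (simp add: powr_powr)
qed

theorem theorem1p2:
  fixes \<phi> :: "'a::euclidean_space \<Rightarrow> real"
    and N :: nat and b1 b2 p1 p2 \<beta> :: real
  assumes "N = DIM('a)" and "N \<ge> 3"
    and "0 < b1" "b1 < 2" "0 < b2" "b2 < 2"
    and "2 < p1" "p1 < 2 * (real N - b1) / (real N - 2)"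
    and "2 < p2" "p2 < 2 * (real N - b2) / (real N - 2)"
    and "2 < (real N * (p1 - 2) + 2 * b1) / 2"
    and "(real N * (p1 - 2) + 2 * b1) / 2 < (real N * (p2 - 2) + 2 * b2) / 2"
    and "b1 < b2" and "p1 < p2"
    and "\<phi> \<in> X_space b1 p1"
    and "positive_radial_decreasing \<phi>"
    and "weak_solution \<phi> (\<lambda>x. norm x powr (- b2) * \<bar>\<phi> x\<bar> powr (p2 - 2) * \<phi> x
                              - norm x powr (- b1) * \<bar>\<phi> x\<bar> powr (p1 - 2) * \<phi> x)"
    and "\<beta> = max ((2 - b1) / (p1 - 2)) (real N - 2)"
  shows "\<beta> > 0 \<and>
    (p1 \<noteq> (2 * real N - 2 - b1) / (real N - 2) \<longrightarrow>
       comparable_at_infinity \<phi> (\<lambda>x. norm x powr (- \<beta>))) \<and>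
    (p1 = (2 * real N - 2 - b1) / (real N - 2) \<longrightarrow>
       comparable_at_infinity \<phi>
         (\<lambda>x. norm x powr (2 - real N) * ln (norm x) powr ((2 - real N) / (2 - b1))))"
proof -
  note N = assms(1) and p = assms(7) assms(14)
  have N3: "3 \<le> real N" using assms(2) by simp
  define n where "n = real N / 2 - 1"
  have n_pos: "0 < n" and N2: "real N - 2 = 2 * n" using N3 by (auto simp: n_def)
  obtain e :: 'a where "e \<in> Basis" using nonempty_Basis by blast
  then have e: "norm e = 1" by simp
  \<comment> \<open>At s = 0 the profile takes the value of \<open>\<phi>\<close> at the origin, so that \<open>\<phi>\<close> equals v (x \<bullet> x) everywhere.\<close>
  define v where "v s = (if 0 \<le> s then \<phi> (sqrt s *\<^sub>R e) else 0)" for s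
  have pos: "\<And>x. x \<noteq> 0 \<Longrightarrow> 0 < \<phi> x" and rad: "\<And>x y. norm x = norm y \<Longrightarrow> \<phi> x = \<phi> y"
    and dec: "\<And>x y. x \<noteq> 0 \<Longrightarrow> norm x \<le> norm y \<Longrightarrow> \<phi> y \<le> \<phi> x"
    using assms(16) unfolding positive_radial_decreasing_def by blast+
  have \<phi>v: "\<phi> x = v (x \<bullet> x)" for x
    unfolding v_def using e by (auto intro!: rad simp: norm_eq_sqrt_inner[symmetric])
  have e0: "e \<noteq> 0" using e by auto
  have v_pos: "0 < v s" if "0 < s" for s
    using that e0 by (auto simp: v_def intro!: pos)
  have v_antimono: "v t \<le> v s" if "0 < s" "s \<le> t" for s t
    using that e e0 by (auto simp: v_def intro!: dec)
  have v_meas [measurable]: "v \<in> borel_measurable borel"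
    by (rule borel_measurable_nonincreasing_profile) (auto simp: v_antimono, simp add: v_def)
  define F where "F s = s powr (- b2 / 2) * \<bar>v s\<bar> powr (p2 - 2) * v s
      - s powr (- b1 / 2) * \<bar>v s\<bar> powr (p1 - 2) * v s" for s
  have F_meas: "F \<in> borel_measurable borel" unfolding F_def by measurable
  define W where "W s = (if 0 < s then s powr n * F s else 0)" for s
  interpret radial_weak_equation n v W
    unfolding W_def[abs_def] n_def N
    using assms(17) v_pos v_antimono v_meas F_meas
    by (intro radial_weak_equation_of_weak_solution[where u=\<phi>])
       (auto simp: \<phi>v F_def norm_powr_even less_imp_le)
  have F_eq: "F s = s powr (- b2 / 2) * v s powr (p2 - 1) - s powr (- b1 / 2) * v s powr (p1 - 1)"
    if "0 < s" for s
  proof -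
    have "v s powr (q - 2) * v s = v s powr (q - 1)" for q
    proof -
      have "v s powr (q - 1) = v s powr (q - 2) * v s powr 1"
        by (simp only: powr_add[symmetric]) simp
      then show ?thesis using v_pos[OF that] by simp
    qed
    then show ?thesis using v_pos[OF that] by (simp add: F_def mult.assoc)
  qed
  have W_cont: "isCont W s" if s: "0 < s" for s
  proof -
    have "isCont (\<lambda>s. s powr n * (s powr (- b2 / 2) * v s powr (p2 - 1) - s powr (- b1 / 2) * v s powr (p1 - 1))) s"
      using s v_pos[OF s] profile_continuous[OF s] by (intro continuous_intros) auto
    moreover have "eventually (\<lambda>s. s powr n * (s powr (- b2 / 2) * v s powr (p2 - 1) - s powr (- b1 / 2) * v s powr (p1 - 1)) = W s) (nhds s)"
      using eventually_nhds_in_open[of "{0<..}" s] s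
      by (auto elim!: eventually_mono simp: W_def F_eq)
    ultimately show ?thesis by (simp add: isCont_cong)
  qed
  define \<gamma> where "\<gamma> = 2 - p1 + (2 - b1) / (2 * n)"
  obtain t0 where "emden_fowler (\<lambda>t. t * v (t powr (1 / n)))
     (\<lambda>t. v (t powr (1 / n)) - integral {0..t powr (1 / n)} W / (4 * n * t))
     (\<lambda>t. - (t powr (1 / n) * W (t powr (1 / n))) / (4 * n\<^sup>2 * t\<^sup>2))
     t0 \<gamma> (p1 - 1) (1 / (8 * n\<^sup>2)) (1 / (4 * n\<^sup>2))"
    unfolding \<gamma>_def
  proof (rule emden_fowler_of_radial_ode[of n b1 b2 p1 p2 v "\<lambda>s. integral {0..s} W" W])
    show "W s = s powr n * (s powr (- b2 / 2) * v s powr (p2 - 1) - s powr (- b1 / 2) * v s powr (p1 - 1))"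
      if "0 < s" for s
      using that by (simp add: W_def F_eq)
  qed (use n_pos assms(4,13) p v_pos v_antimono profile_ode[OF W_cont] in auto)
  then interpret ef: emden_fowler "\<lambda>t. t * v (t powr (1 / n))"
     "\<lambda>t. v (t powr (1 / n)) - integral {0..t powr (1 / n)} W / (4 * n * t)"
     "\<lambda>t. - (t powr (1 / n) * W (t powr (1 / n))) / (4 * n\<^sup>2 * t\<^sup>2)"
     t0 \<gamma> "p1 - 1" "1 / (8 * n\<^sup>2)" "1 / (4 * n\<^sup>2)" .
  have q: "p1 - 1 - 1 = p1 - 2" by simp
  define t where "t x = norm x powr (2 * n)" for x :: 'a
  have t_eq: "t x * v (t x powr (1 / n)) = \<phi> x * t x" if "x \<noteq> 0" for x
  proof -
    have "t x powr (1 / n) = norm x powr 2" using n_pos by (simp add: t_def powr_powr)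
    also have "\<dots> = x \<bullet> x" using that by (simp add: power2_norm_eq_inner)
    finally show ?thesis by (simp add: \<phi>v)
  qed
  have large: "x \<noteq> 0 \<and> 1 < norm x \<and> 0 < t x \<and> T \<le> t x" if "max 2 (\<bar>T\<bar> powr (1 / (2 * n))) \<le> norm x" for x T
  proof -
    have nx: "2 \<le> norm x" "\<bar>T\<bar> powr (1 / (2 * n)) \<le> norm x" using that by auto
    have "\<bar>T\<bar> = (\<bar>T\<bar> powr (1 / (2 * n))) powr (2 * n)" using n_pos by (simp add: powr_powr)
    also have "\<dots> \<le> t x" unfolding t_def using nx n_pos by (intro powr_mono2) auto
    finally have "T \<le> t x" by simp
    moreover have "x \<noteq> 0" using nx by auto
    ultimately show ?thesis using nx by (simp add: t_def)
  qed
  have compare: "comparable_at_infinity \<phi> (\<lambda>x. g (t x) / t x)"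
    if "0 < c" and "\<And>\<tau>. T \<le> \<tau> \<Longrightarrow> 0 \<le> g \<tau> \<and> c * g \<tau> \<le> \<tau> * v (\<tau> powr (1 / n)) \<and> \<tau> * v (\<tau> powr (1 / n)) \<le> C * g \<tau>"
    for c C T and g :: "real \<Rightarrow> real"
  proof (rule comparable_at_infinityI[OF that(1)])
    fix x :: 'a assume x: "max 2 (\<bar>T\<bar> powr (1 / (2 * n))) \<le> norm x"
    note l = large[OF x]
    have "0 \<le> g (t x) \<and> c * g (t x) \<le> \<phi> x * t x \<and> \<phi> x * t x \<le> C * g (t x)"
      using that(2)[of "t x"] l t_eq[of x] by auto
    then show "0 \<le> g (t x) / t x \<and> c * (g (t x) / t x) \<le> \<phi> x \<and> \<phi> x \<le> C * (g (t x) / t x)"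
      using l by (simp add: pos_divide_le_eq pos_le_divide_eq)
  qed auto
  have congr: "comparable_at_infinity \<phi> g2"
    if "comparable_at_infinity \<phi> g1" "\<And>x. 1 < norm x \<Longrightarrow> g1 x = C * g2 x" "0 < C"
      "\<And>x. 1 < norm x \<Longrightarrow> 0 \<le> g2 x"
    for g1 g2 :: "'a \<Rightarrow> real" and C
  proof -
    from that(1) obtain c d R where *: "0 < c" "0 < R"
      "\<And>x. R \<le> norm x \<Longrightarrow> c * g1 x \<le> \<phi> x \<and> \<phi> x \<le> d * g1 x"
      unfolding comparable_at_infinity_def by blast
    show ?thesis
    proof (rule comparable_at_infinityI[of "c * C" "max 2 R" _ _ "d * C"])
      fix x :: 'a assume "max 2 R \<le> norm x"
      then show "0 \<le> g2 x \<and> c * C * g2 x \<le> \<phi> x \<and> \<phi> x \<le> d * C * g2 x"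
        using *(3)[of x] that(2)[of x] that(4)[of x] by (simp add: mult.assoc)
    qed (use * that in auto)
  qed
  have t_inv: "1 / t x = norm x powr (2 - real N)" for x :: 'a
  proof -
    have "2 - real N = - (2 * n)" using N2 by simp
    then show ?thesis by (simp add: t_def powr_minus_divide)
  qed
  have crit: "p1 = (2 * real N - 2 - b1) / (real N - 2) \<longleftrightarrow> \<gamma> = 0"
  proof -
    have "(2 * real N - 2 - b1) / (real N - 2) = 2 + (2 - b1) / (2 * n)"
      unfolding N2 using n_pos by (simp add: n_def field_simps)
    then show ?thesis by (auto simp: \<gamma>_def)
  qed
  have ratio: "(2 - b1) / (p1 - 2) = 2 * n * (1 + \<gamma> / (p1 - 2))"
    using n_pos p(1) by (simp add: \<gamma>_def field_simps)
  \<comment> \<open>The maximum defining \<open>\<beta>\<close> is attained by its first argument exactly if \<open>\<gamma>\<close> is nonnegative.\<close>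
  have max_scale: "max (2 * n * (1 + w)) (2 * n) = 2 * n * (1 + max 0 w)" for w
  proof (cases "0 \<le> w")
    case True
    then have "2 * n * 1 \<le> 2 * n * (1 + w)" using n_pos by (intro mult_left_mono) auto
    then show ?thesis using True by simp
  next
    case False
    then have "2 * n * (1 + w) \<le> 2 * n * 1" using n_pos by (intro mult_left_mono) auto
    then show ?thesis using False by simp
  qed
  have \<beta>: "\<beta> = 2 * n * (1 + max 0 (\<gamma> / (p1 - 2)))"
    unfolding assms(18) N2 ratio max_scale ..
  show ?thesis
  proof (intro conjI impI)
    show "\<beta> > 0" using assms(18) N3 by simp
    assume "p1 \<noteq> (2 * real N - 2 - b1) / (real N - 2)"
    then consider "\<gamma> < 0" | "0 < \<gamma>" unfolding crit by linarith
    then show "comparable_at_infinity \<phi> (\<lambda>x. norm x powr (- \<beta>))"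
    proof cases
      case 1
      then obtain c C where "0 < c" "\<And>\<tau>. t0 \<le> \<tau> \<Longrightarrow> c \<le> \<tau> * v (\<tau> powr (1 / n)) \<and> \<tau> * v (\<tau> powr (1 / n)) \<le> C"
        using ef.asymp_neg by blast
      then have "comparable_at_infinity \<phi> (\<lambda>x. 1 / t x)"
        by (intro compare[of c t0 "\<lambda>_. 1" C]) auto
      moreover have "\<beta> = real N - 2"
        using divide_neg_pos[of \<gamma> "p1 - 2"] 1 p(1) N2 by (simp add: \<beta>)
      ultimately show ?thesis unfolding t_inv by simp
    next
      case 2
      then obtain c C where "0 < c" "\<And>\<tau>. t0 \<le> \<tau> \<Longrightarrow> c * \<tau> powr (- (\<gamma> / (p1 - 2))) \<le> \<tau> * v (\<tau> powr (1 / n)) \<and>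
          \<tau> * v (\<tau> powr (1 / n)) \<le> C * \<tau> powr (- (\<gamma> / (p1 - 2)))"
        using ef.asymp_pos unfolding q by blast
      then have "comparable_at_infinity \<phi> (\<lambda>x. t x powr (- (\<gamma> / (p1 - 2))) / t x)"
        by (intro compare[of c t0 "\<lambda>\<tau>. \<tau> powr (- (\<gamma> / (p1 - 2)))" C]) auto
      moreover have "\<beta> = 2 * n * (1 + \<gamma> / (p1 - 2))"
        using 2 p(1) by (simp add: \<beta>)
      then have "2 * n * (- (\<gamma> / (p1 - 2))) - 2 * n = - \<beta>" by (simp add: algebra_simps)
      then have "t x powr (- (\<gamma> / (p1 - 2))) / t x = norm x powr (- \<beta>)" for x
        by (simp only: t_def powr_powr powr_diff[symmetric])
      ultimately show ?thesis by simp
    qed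
  next
    assume "p1 = (2 * real N - 2 - b1) / (real N - 2)"
    then have \<gamma>0: "\<gamma> = 0" by (simp add: crit)
    let ?E = "(2 - real N) / (2 - b1)"
    have "(2 - b1) / (p1 - 2) = 2 * n" using ratio \<gamma>0 by simp
    then have E: "- 1 / (p1 - 2) = ?E"
      using N2 n_pos p(1) assms(4) by (simp add: field_simps)
    obtain c C T where "0 < c" "1 < T" "\<And>\<tau>. T \<le> \<tau> \<Longrightarrow> c * ln \<tau> powr ?E \<le> \<tau> * v (\<tau> powr (1 / n)) \<and>
        \<tau> * v (\<tau> powr (1 / n)) \<le> C * ln \<tau> powr ?E"
      by (rule ef.asymp_critical[OF \<gamma>0, unfolded q E]) (rule that)
    then have "comparable_at_infinity \<phi> (\<lambda>x. ln (t x) powr ?E / t x)"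
      by (intro compare[of c T "\<lambda>\<tau>. ln \<tau> powr ?E" C]) auto
    then show "comparable_at_infinity \<phi> (\<lambda>x. norm x powr (2 - real N) * ln (norm x) powr ?E)"
    proof (rule congr[where C = "(2 * n) powr ?E"])
      fix x :: 'a assume x: "1 < norm x"
      have ln_t: "ln (t x) = (2 * n) * ln (norm x)" using x by (simp add: t_def ln_powr)
      have split: "ln (t x) powr ?E = (2 * n) powr ?E * ln (norm x) powr ?E"
        unfolding ln_t by (rule powr_mult)
      have "ln (t x) powr ?E / t x = ln (t x) powr ?E * (1 / t x)" by simp
      also have "\<dots> = (2 * n) powr ?E * (norm x powr (2 - real N) * ln (norm x) powr ?E)"
        unfolding split t_inv by (simp only: mult_ac)
      finally show "ln (t x) powr ?E / t x = (2 * n) powr ?E * (norm x powr (2 - real N) * ln (norm x) powr ?E)" .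
    qed (use n_pos in auto)
  qed
qed

end
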